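(* Let $n\ge1$ and let $P\subseteq\mathcal{B}_n$ be the set of $\sigma$-positive elements. For each $\phi\in\mathcal{B}_n$, exactly one of the following holds: - $\phi=1$; - $\phi\in P$; - $\phi^{-1}\in P$. Moreover $PP\subseteq P$, so $P$ is the positive cone of a right-invariant total ordering of $\mathcal{B}_n$.
   Context: $\Sigma_{0,1,n}$ is the free group with free basis $t_1,\dots,t_n$, and $z_1:=(t_1\cdots t_n)^{-1}$. Automorphisms act on the right and compose left to right. $\mathcal{B}_n$ is the group of all automorphisms $\phi$ of $\Sigma_{0,1,n}$ such that $z_1^\phi=z_1$ and $\phi$ permutes the set of conjugacy classes $\{[t_1],\dots,[t_n]\}$. For $i\in\{1,\dots,n-1\}$, $\sigma_i$ is given by $t_k^{\sigma_i}=t_k$ for $k\notin\{i,i+1\}$, $t_i^{\sigma_i}=t_{i+1}$, and $t_{i+1}^{\sigma_i}=t_{i+1}^{-1}t_it_{i+1}$. An element $\phi\in\mathcal{B}_n$ is $\sigma$-positive if $n\ge2$ and, for some $i\in\{1,\dots,n-1\}$, $\phi$ is a product of a finite sequence of elements of $\{\sigma_i,\dots,\sigma_{n-1}\}\cup\{\sigma_{i+1}^{-1},\dots,\sigma_{n-1}^{-1}\}$ in which $\sigma_i$ occurs at least once. *)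

theory Defs
  imports "HOL-Algebra.Group"
begin

text \<open>Letters: (i, True) stands for t_i and (i, False) for t_i^{-1}.
  Elements of the free group are freely reduced words.\<close>

type_synonym letter = "nat \<times> bool"

definition linv :: "letter \<Rightarrow> letter" where
  "linv x = (fst x, \<not> snd x)"

fun red :: "letter list \<Rightarrow> letter list" where
  "red [] = []"
| "red (x # xs) = (case red xs of [] \<Rightarrow> [x]
                    | y # ys \<Rightarrow> (if y = linv x then ys else x # y # ys))"

definition reduced :: "letter list \<Rightarrow> bool" where
  "reduced w \<longleftrightarrow> (\<forall>i. Suc i < length w \<longrightarrow> w ! Suc i \<noteq> linv (w ! i))"

definition winv :: "letter list \<Rightarrow> letter list" where
  "winv w = rev (map linv w)"

definition FG :: "nat \<Rightarrow> letter list monoid" where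
  "FG n = \<lparr> carrier = {w. reduced w \<and> set w \<subseteq> {1..n} \<times> UNIV},
            mult = (\<lambda>u v. red (u @ v)),
            one = [] \<rparr>"

definition gen :: "nat \<Rightarrow> letter list" where
  "gen i = [(i, True)]"

definition z1 :: "nat \<Rightarrow> letter list" where
  "z1 n = winv (map (\<lambda>i. (i, True)) [1..<Suc n])"

definition conjclass :: "nat \<Rightarrow> letter list \<Rightarrow> letter list set" where
  "conjclass n x = {red (g @ x @ winv g) | g. g \<in> carrier (FG n)}"

text \<open>Automorphisms are represented as functions on the carrier, extensional
  (undefined) outside it. x^phi is phi x.\<close>

definition bone :: "nat \<Rightarrow> letter list \<Rightarrow> letter list" where
  "bone n = restrict id (carrier (FG n))"

text \<open>Left-to-right composition: x^(phi psi) = (x^phi)^psi.\<close>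
definition bcomp :: "nat \<Rightarrow> (letter list \<Rightarrow> letter list) \<Rightarrow> (letter list \<Rightarrow> letter list)
                      \<Rightarrow> letter list \<Rightarrow> letter list" where
  "bcomp n \<phi> \<psi> = restrict (\<psi> \<circ> \<phi>) (carrier (FG n))"

definition binv :: "nat \<Rightarrow> (letter list \<Rightarrow> letter list) \<Rightarrow> letter list \<Rightarrow> letter list" where
  "binv n \<phi> = restrict (inv_into (carrier (FG n)) \<phi>) (carrier (FG n))"

definition bprod :: "nat \<Rightarrow> (letter list \<Rightarrow> letter list) list \<Rightarrow> letter list \<Rightarrow> letter list" where
  "bprod n fs = foldl (bcomp n) (bone n) fs"

definition Bn :: "nat \<Rightarrow> (letter list \<Rightarrow> letter list) set" where
  "Bn n = {\<phi>. \<phi> \<in> iso (FG n) (FG n) \<and> \<phi> \<in> extensional (carrier (FG n))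
             \<and> \<phi> (z1 n) = z1 n
             \<and> (\<lambda>C. \<phi> ` C) ` (conjclass n ` gen ` {1..n}) = conjclass n ` gen ` {1..n}}"

definition ext_hom :: "(nat \<Rightarrow> letter list) \<Rightarrow> letter list \<Rightarrow> letter list" where
  "ext_hom f w = red (concat (map (\<lambda>x. if snd x then f (fst x) else winv (f (fst x))) w))"

definition sigma_img :: "nat \<Rightarrow> nat \<Rightarrow> letter list" where
  "sigma_img i k = (if k = i then [(Suc i, True)]
                    else if k = Suc i then [(Suc i, False), (i, True), (Suc i, True)]
                    else [(k, True)])"

definition sigma :: "nat \<Rightarrow> nat \<Rightarrow> letter list \<Rightarrow> letter list" where
  "sigma n i = restrict (ext_hom (sigma_img i)) (carrier (FG n))"

definition sigma_positive :: "nat \<Rightarrow> (letter list \<Rightarrow> letter list) \<Rightarrow> bool" where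
  "sigma_positive n \<phi> \<longleftrightarrow> n \<ge> 2 \<and>
     (\<exists>i \<in> {1..n-1}. \<exists>fs.
        set fs \<subseteq> sigma n ` {i..n-1} \<union> (\<lambda>j. binv n (sigma n j)) ` {Suc i..n-1}
        \<and> sigma n i \<in> set fs \<and> \<phi> = bprod n fs)"

definition Ppos :: "nat \<Rightarrow> (letter list \<Rightarrow> letter list) set" where
  "Ppos n = {\<phi> \<in> Bn n. sigma_positive n \<phi>}"

definition bless :: "nat \<Rightarrow> (letter list \<Rightarrow> letter list) \<Rightarrow> (letter list \<Rightarrow> letter list) \<Rightarrow> bool" where
  "bless n \<phi> \<psi> \<longleftrightarrow> bcomp n \<psi> (binv n \<phi>) \<in> Ppos n"

end

theory Submission
  imports Defs
begin

text \<open>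
  Write \<open>A\<^sub>k\<close> for the image of \<open>t\<^sub>k\<close> under \<open>\<phi>\<close>: a conjugate of a generator, and
  \<open>A\<^sub>1 \<cdots> A\<^sub>n = t\<^sub>1 \<cdots> t\<^sub>n\<close>. Multiplying \<open>\<phi>\<close> on the left by \<open>\<sigma>\<^sub>j\<close> or its inverse is a Hurwitz move
  on the pair \<open>A\<^sub>j, A\<^sub>j\<^sub>+\<^sub>1\<close>.

  Suppose \<open>\<phi>\<close> fixes \<open>t\<^sub>1, \<dots>, t\<^sub>i\<^sub>-\<^sub>1\<close> but not \<open>t\<^sub>i\<close>. As in Artin's argument, moves on
  \<open>A\<^sub>i\<^sub>+\<^sub>1, \<dots>, A\<^sub>n\<close> that minimise their total length lead to a tuple in which no middle letter cancels
  in the product \<open>A\<^sub>i\<^sub>+\<^sub>1 \<cdots> A\<^sub>n\<close>. So the reduced word \<open>W\<close> of \<open>A\<^sub>i\<inverse> t\<^sub>i \<cdots> t\<^sub>n\<close> contains \<open>n - i\<close> marked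
  letters, the middle letters, and its other letters multiply to 1. Writing \<open>A\<^sub>i = p t p\<inverse>\<close>, a comparison of
  lengths shows that a marked letter lies in the second half \<open>p\<inverse> t\<^sub>i\<close> of \<open>W\<close> if \<open>A\<^sub>i\<close> does not
  start with \<open>t\<^sub>i\<close>, and in its first half \<open>p\<close> if it does. Moving the conjugate with that middle letter next to
  \<open>A\<^sub>i\<close> and applying \<open>\<sigma>\<^sub>i\<inverse>\<close>, respectively \<open>\<sigma>\<^sub>i\<close>, replaces \<open>A\<^sub>i\<close> by a shorter word of the same kind
  or by \<open>t\<^sub>i\<close>. By induction \<open>\<phi>\<close>, respectively its inverse, is \<open>\<sigma>\<close>-positive.

  Conversely (Larue), \<open>\<sigma>\<^sub>i\<inverse>\<close> and all \<open>\<sigma>\<^sub>j\<close> and \<open>\<sigma>\<^sub>j\<inverse>\<close> with \<open>j > i\<close> preserve the set of words starting with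
  \<open>t\<^sub>i\<close>. Hence a \<open>\<sigma>\<close>-positive \<open>\<phi>\<close> with index \<open>i\<close> moves \<open>t\<^sub>i\<close> out of this set, and is not the identity.
\<close>

section \<open>Free reduction\<close>

lemma linv_linv [simp]: "linv (linv x) = x"
  by (simp add: linv_def)

lemma linv_neq [simp]: "linv x \<noteq> x" "x \<noteq> linv x"
  by (simp_all add: linv_def prod_eq_iff)

lemma linv_eq_iff [simp]: "linv x = linv y \<longleftrightarrow> x = y"
  by (metis linv_linv)

lemma fst_linv [simp]: "fst (linv x) = fst x"
  by (simp add: linv_def)

lemma snd_linv [simp]: "snd (linv x) = (\<not> snd x)"
  by (simp add: linv_def)

lemma linv_Pair [simp]: "linv (k, e) = (k, \<not> e)"
  by (simp add: linv_def)

lemma reduced_Nil [simp]: "reduced []"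
  by (simp add: reduced_def)

lemma reduced_Cons:
  "reduced (x # w) \<longleftrightarrow> reduced w \<and> (w \<noteq> [] \<longrightarrow> hd w \<noteq> linv x)"
proof
  assume *: "reduced (x # w)"
  have "reduced w"
    unfolding reduced_def
  proof (intro allI impI)
    fix i assume "Suc i < length w"
    with * show "w ! Suc i \<noteq> linv (w ! i)"
      unfolding reduced_def by (metis Suc_mono length_Cons nth_Cons_Suc)
  qed
  moreover have "w \<noteq> [] \<longrightarrow> hd w \<noteq> linv x"
    using *[unfolded reduced_def, rule_format, of 0] by (cases w) auto
  ultimately show "reduced w \<and> (w \<noteq> [] \<longrightarrow> hd w \<noteq> linv x)" by simp
next
  assume *: "reduced w \<and> (w \<noteq> [] \<longrightarrow> hd w \<noteq> linv x)"
  show "reduced (x # w)"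
    unfolding reduced_def
  proof (intro allI impI)
    fix i assume i: "Suc i < length (x # w)"
    show "(x # w) ! Suc i \<noteq> linv ((x # w) ! i)"
    proof (cases i)
      case 0
      then show ?thesis using i * by (cases w) auto
    next
      case (Suc j)
      then show ?thesis using i * by (simp add: reduced_def)
    qed
  qed
qed

lemma reduced_single [simp]: "reduced [x]"
  by (simp add: reduced_Cons)

lemma reduced_append:
  "reduced (u @ v) \<longleftrightarrow> reduced u \<and> reduced v \<and> (u \<noteq> [] \<longrightarrow> v \<noteq> [] \<longrightarrow> hd v \<noteq> linv (last u))"
  by (induction u) (auto simp: reduced_Cons)

lemma red_eq: "reduced w \<Longrightarrow> red w = w"
  by (induction w) (auto simp: reduced_Cons split: list.split)

lemma reduced_red [simp]: "reduced (red w)"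
  by (induction w) (auto simp: reduced_Cons split: list.split)

lemma red_red [simp]: "red (red w) = red w"
  by (simp add: red_eq)

lemma length_red: "length (red w) \<le> length w"
  by (induction w) (auto split: list.split)

lemma set_red: "set (red w) \<subseteq> set w"
proof (induction w)
  case (Cons x w)
  then show ?case by (cases "red w") auto
qed simp

lemma red_append_cong: "red v = red v' \<Longrightarrow> red (u @ v) = red (u @ v')"
  by (induction u) auto

text \<open>If \<open>red w\<close> starts with \<open>x\<close>, the letter \<open>linv x\<close>
  removes it. The letter now in front is not \<open>linv x\<close>, because \<open>red w\<close> is
  reduced, so \<open>x\<close> is put back.\<close>

lemma red_cancel [simp]: "red (x # linv x # w) = red w"
proof -
  have "reduced (red w)" by simp
  then show ?thesis
    by (cases "red w") (auto simp: reduced_Cons split: list.splits)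
qed

lemma red_cancel' [simp]: "red (linv x # x # w) = red w"
  using red_cancel[of "linv x" w] by simp

text \<open>Reducing a prefix first does not change the result. Together with
  \<open>red_append_red\<close> this gives associativity of the multiplication of reduced
  words.\<close>

lemma red_red_append [simp]: "red (red u @ v) = red (u @ v)"
proof (induction u)
  case (Cons x u)
  show ?case
  proof (cases "red u")
    case Nil
    with Cons.IH have "red (u @ v) = red v" by simp
    with Nil show ?thesis by simp
  next
    case u: (Cons y ys)
    show ?thesis
    proof (cases "y = linv x")
      case True
      with u Cons.IH have "red (u @ v) = red (linv x # ys @ v)" by simp
      then have "red ((x # u) @ v) = red (x # linv x # ys @ v)" by simp
      then have "red ((x # u) @ v) = red (ys @ v)" by (metis red_cancel)
      with u True show ?thesis by simp
    next
      case False
      with u have "red (red (x # u) @ v) = red (x # (y # ys) @ v)" by simp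
      also have "\<dots> = red (x # (u @ v))"
        using Cons.IH u by simp
      finally show ?thesis by simp
    qed
  qed
qed simp

lemma red_append_red [simp]: "red (u @ red v) = red (u @ v)"
  by (rule red_append_cong) simp

lemma winv_Nil [simp]: "winv [] = []"
  by (simp add: winv_def)

lemma winv_Cons: "winv (x # w) = winv w @ [linv x]"
  by (simp add: winv_def)

lemma winv_append [simp]: "winv (u @ v) = winv v @ winv u"
  by (simp add: winv_def)

lemma winv_single [simp]: "winv [x] = [linv x]"
  by (simp add: winv_def)

lemma winv_winv [simp]: "winv (winv w) = w"
  by (simp add: winv_def rev_map o_def)

lemma length_winv [simp]: "length (winv w) = length w"
  by (simp add: winv_def)

lemma winv_eq_Nil [simp]: "winv w = [] \<longleftrightarrow> w = []"
  by (simp add: winv_def)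

lemma hd_winv: "w \<noteq> [] \<Longrightarrow> hd (winv w) = linv (last w)"
  by (simp add: winv_def hd_rev last_map)

lemma last_winv: "w \<noteq> [] \<Longrightarrow> last (winv w) = linv (hd w)"
  by (simp add: winv_def last_rev hd_map)

lemma fst_set_winv: "fst ` set (winv w) = fst ` set w"
  by (force simp: winv_def)

lemma reduced_winv [simp]: "reduced (winv w) \<longleftrightarrow> reduced w"
proof -
  have *: "reduced (winv w)" if "reduced w" for w
    using that
  proof (induction w)
    case (Cons x w)
    then show ?case
      by (cases "w = []") (auto simp: winv_Cons reduced_append reduced_Cons last_winv)
  qed simp
  show ?thesis using *[of w] *[of "winv w"] by auto
qed

lemma red_append_winv [simp]: "red (w @ winv w) = []"
proof (induction w)
  case (Cons x w)
  have "red ((x # w) @ winv (x # w)) = red (x # (red (w @ winv w) @ [linv x]))"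
    by (metis append.assoc append_Cons append_Nil red_append_cong red_red_append winv_Cons)
  then show ?case by (simp add: Cons.IH)
qed simp

lemma red_winv_append [simp]: "red (winv w @ w) = []"
  using red_append_winv[of "winv w"] by simp

lemma reduced_if_positive: "\<forall>x\<in>set w. snd x \<Longrightarrow> reduced w"
proof (induction w)
  case (Cons x w)
  then show ?case by (cases w) (auto simp: reduced_Cons)
qed simp

section \<open>The free group on all generators, as a type\<close>

text \<open>A type for the free group on all \<open>t_k\<close>, independent of \<open>n\<close>,
  gives access to the class \<open>group_add\<close> of groups that need not commute: products
  become sums, and conjugates are written \<open>h + x + - h\<close>.\<close>

typedef fgrp = "{w. reduced w}"
  morphisms rep Abs_fgrp
  by (rule exI[of _ "[]"]) simp

definition cl :: "letter list \<Rightarrow> fgrp" where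
  "cl w = Abs_fgrp (red w)"

lemma rep_cl [simp]: "rep (cl w) = red w"
  by (simp add: cl_def Abs_fgrp_inverse)

lemma reduced_rep [simp]: "reduced (rep g)"
  using rep[of g] by simp

lemma cl_rep [simp]: "cl (rep g) = g"
  by (simp add: cl_def red_eq rep_inverse)

lemma cl_eq_iff: "cl u = cl v \<longleftrightarrow> red u = red v"
  by (metis rep_cl cl_def)

lemma cl_red [simp]: "cl (red w) = cl w"
  by (simp add: cl_eq_iff)

lemma cl_inject: "reduced u \<Longrightarrow> reduced v \<Longrightarrow> cl u = cl v \<longleftrightarrow> u = v"
  by (simp add: cl_eq_iff red_eq)

text \<open>Reduction never lengthens a word, so a reduced word is shortest among the words for its
  element. The counting arguments on marked words end in this inequality.\<close>

lemma length_le_if_cl_eq: "reduced u \<Longrightarrow> cl u = cl v \<Longrightarrow> length u \<le> length v"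
  by (metis cl_eq_iff length_red red_eq)

instantiation fgrp :: group_add
begin

definition "0 = cl []"
definition "g + h = cl (rep g @ rep h)"
definition "- g = cl (winv (rep g))"
definition "g - h = g + (- h :: fgrp)"

instance
proof
  fix a b c :: fgrp
  show "a + b + c = a + (b + c)"
    by (simp add: plus_fgrp_def cl_eq_iff)
  show "0 + a = a" "a + 0 = a"
    by (simp_all add: plus_fgrp_def zero_fgrp_def)
  show "- a + a = 0"
    by (simp add: plus_fgrp_def uminus_fgrp_def zero_fgrp_def cl_eq_iff)
  show "a + - b = a - b"
    by (simp add: minus_fgrp_def)
qed

end

lemma cl_Nil [simp]: "cl [] = 0"
  by (simp add: zero_fgrp_def)

lemma cl_append: "cl (u @ v) = cl u + cl v"
  by (simp add: plus_fgrp_def cl_eq_iff)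

lemma cl_Cons: "cl (x # v) = cl [x] + cl v"
  using cl_append[of "[x]" v] by simp

lemma cl_winv: "cl (winv w) = - cl w"
proof -
  have "cl (winv w) + cl w = 0"
    unfolding cl_append[symmetric] zero_fgrp_def cl_eq_iff by simp
  then show ?thesis by (simp add: eq_neg_iff_add_eq_0)
qed

lemma cl_linv [simp]: "cl [linv x] = - cl [x]"
  using cl_winv[of "[x]"] by simp

lemma cl_False [simp]: "cl [(k, False)] = - cl [(k, True)]"
  using cl_linv[of "(k, True)"] by simp

lemma cl_letter: "cl [x] = (if snd x then cl [(fst x, True)] else - cl [(fst x, True)])"
  by (cases x) auto

lemma rep_0 [simp]: "rep 0 = []"
  using rep_cl[of "[]"] by simp

lemma rep_eq_Nil [simp]: "rep g = [] \<longleftrightarrow> g = 0"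
  by (metis cl_rep cl_Nil rep_0)

abbreviation tg :: "nat \<Rightarrow> fgrp" where
  "tg k \<equiv> cl [(k, True)]"

lemma rep_tg [simp]: "rep (tg k) = [(k, True)]"
  by (simp add: red_eq reduced_Cons)

text \<open>Differences are expanded into sums with negatives, so that conjugates normalise by
  associativity and cancellation. For this reason the opposite default rule is switched off
  next.\<close>

lemmas grp_simps = add.assoc diff_conv_add_uminus minus_add

declare add_uminus_conv_diff [simp del]

section \<open>Conjugates of generators\<close>

text \<open>Keeping the generator and the conjugating word as data makes the middle letter of a
  conjugate accessible even after products have been formed.\<close>

definition cval :: "nat \<times> letter list \<Rightarrow> fgrp" where
  "cval c = cl (snd c) + tg (fst c) + - cl (snd c)"

definition tight :: "nat \<times> letter list \<Rightarrow> bool" where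
  "tight c \<longleftrightarrow> reduced (snd c @ (fst c, True) # winv (snd c))"

lemma cval_word: "cval (a, u) = cl (u @ (a, True) # winv u)"
  by (simp add: cval_def cl_append cl_Cons[of "(a, True)" "winv u"] cl_winv grp_simps)

lemma tight_iff:
  "tight (a, u) \<longleftrightarrow> reduced u \<and> (u \<noteq> [] \<longrightarrow> fst (last u) \<noteq> a)"
  by (cases "u = []"; cases "last u")
     (auto simp: tight_def reduced_append reduced_Cons hd_winv)

lemma rep_cval: "tight (a, u) \<Longrightarrow> rep (cval (a, u)) = u @ (a, True) # winv u"
  by (simp add: cval_word red_eq tight_def)

lemma length_rep_cval_le: "length (rep (cval (a, u))) \<le> 2 * length u + 1"
  using length_red[of "u @ (a, True) # winv u"] by (simp add: cval_word)

lemma tg_letter_commute: "fst x = a \<Longrightarrow> cl [x] + tg a = tg a + cl [x]"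
  by (cases x; cases "snd x") auto

text \<open>Trailing letters \<open>t_a\<close> and \<open>t_a^-1\<close> of \<open>g\<close>
  commute with \<open>t_a\<close> and drop out of the conjugate; \<open>v\<close> collects
  them.\<close>

lemma conj_normal_form:
  assumes "reduced g"
  obtains u v where "g = u @ v" "fst ` set v \<subseteq> {a}" "tight (a, u)" "cval (a, g) = cval (a, u)"
proof -
  have "\<exists>u v. g = u @ v \<and> fst ` set v \<subseteq> {a} \<and> tight (a, u) \<and> cval (a, g) = cval (a, u)"
    using assms
  proof (induction g rule: rev_induct)
    case Nil
    then show ?case by (auto simp: tight_iff)
  next
    case (snoc x g)
    show ?case
    proof (cases "fst x = a")
      case False
      with snoc.prems have "tight (a, g @ [x])" by (simp add: tight_iff)
      then show ?thesis by (intro exI[of _ "g @ [x]"] exI[of _ "[]"]) simp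
    next
      case True
      from snoc.prems have "reduced g" by (simp add: reduced_append)
      with snoc.IH obtain u v where uv: "g = u @ v" "fst ` set v \<subseteq> {a}" "tight (a, u)"
        "cval (a, g) = cval (a, u)" by blast
      have "cl [x] + tg a + - cl [x] = tg a"
        by (simp add: tg_letter_commute[OF True] grp_simps)
      then have "cval (a, g @ [x]) = cval (a, g)"
        by (simp add: cval_def cl_append grp_simps) (simp add: grp_simps flip: add.assoc)
      with uv True show ?thesis
        by (intro exI[of _ u] exI[of _ "v @ [x]"]) auto
    qed
  qed
  with that show ?thesis by blast
qed

text \<open>Two consecutive conjugates are loose if multiplying them cancels the middle letter
  of one of them; then a Hurwitz move shortens that one.\<close>

definition loose_left :: "nat \<times> letter list \<Rightarrow> nat \<times> letter list \<Rightarrow> bool" where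
  "loose_left c d \<longleftrightarrow> (let s = red (winv (snd c) @ snd d) in s \<noteq> [] \<and> hd s = (fst c, False))"

definition loose_right :: "nat \<times> letter list \<Rightarrow> nat \<times> letter list \<Rightarrow> bool" where
  "loose_right c d \<longleftrightarrow> (let s = red (winv (snd c) @ snd d) in s \<noteq> [] \<and> last s = (fst d, False))"

text \<open>If \<open>u^-1 v\<close> begins with \<open>t_a^-1\<close>, then
  \<open>v = u t_a^-1 s'\<close>, where tightness of \<open>c\<close> rules out cancellation.
  Conjugation by \<open>u t_a u^-1\<close> turns \<open>v\<close> into \<open>u s'\<close>, which is
  one letter shorter.\<close>

lemma loose_left_shortens:
  assumes c: "tight c" and d: "tight d" and "loose_left c d"
  shows "length (rep (cval c + cval d + - cval c)) < length (rep (cval d))"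
proof -
  obtain a u b v where cd: "c = (a, u)" "d = (b, v)" by force
  define s where "s = red (winv u @ v)"
  obtain s' where s': "s = (a, False) # s'"
    using assms(3) by (cases s) (auto simp: loose_left_def Let_def cd s_def)
  have "cl s = - cl u + cl v" by (simp add: s_def cl_append cl_winv)
  then have v: "cl v = cl (u @ (a, False) # s')"
    by (simp add: cl_append flip: s')
  have "reduced s" by (simp add: s_def)
  with c have "reduced (u @ (a, False) # s')"
    by (cases "u = []"; cases "last u") (auto simp: s' cd tight_iff reduced_append)
  with v d have veq: "v = u @ (a, False) # s'"
    using cl_inject by (simp add: cd tight_iff)
  have "cval c + cval d + - cval c = cval (b, u @ s')"
    by (simp add: cd cval_def veq cl_append cl_Cons[of "(a, False)" s'] grp_simps)
  then show ?thesis
    using length_rep_cval_le[of b "u @ s'"] d by (simp add: rep_cval cd) (simp add: veq)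
qed

text \<open>The mirror case: here \<open>u = v t_b s'^-1\<close>, and conjugation by the inverse of
  \<open>cval d\<close> removes the letter \<open>t_b\<close>.\<close>

lemma loose_right_shortens:
  assumes c: "tight c" and d: "tight d" and "loose_right c d"
  shows "length (rep (- cval d + cval c + cval d)) < length (rep (cval c))"
proof -
  obtain a u b v where cd: "c = (a, u)" "d = (b, v)" by force
  define s where "s = red (winv u @ v)"
  obtain s' where s': "s = s' @ [(b, False)]"
    using assms(3) by (cases s rule: rev_cases) (auto simp: loose_right_def Let_def cd s_def)
  have "cl s = - cl u + cl v" by (simp add: s_def cl_append cl_winv)
  then have "cl u = cl v + - cl s" by (simp add: grp_simps)
  then have u: "cl u = cl (v @ (b, True) # winv s')"
    by (simp add: cl_append s' cl_Cons[of "(b, True)" "winv s'"] cl_winv grp_simps)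
  have "reduced (winv s)" by (simp add: s_def)
  with d have "reduced (v @ (b, True) # winv s')"
    by (cases "v = []"; cases "last v") (auto simp: s' cd tight_iff reduced_append)
  with u c have ueq: "u = v @ (b, True) # winv s'"
    using cl_inject by (simp add: cd tight_iff)
  have "- cval d + cval c + cval d = cval (a, v @ winv s')"
    by (simp add: cd cval_def ueq cl_append cl_Cons[of "(b, True)" "winv s'"] grp_simps)
  then show ?thesis
    using length_rep_cval_le[of a "v @ winv s'"] c by (simp add: rep_cval cd) (simp add: ueq)
qed

section \<open>Marked words\<close>

text \<open>The word of a product of conjugates (started after a prefix \<open>p\<close>), in which each middle
  letter is marked. Without loose neighbours it is reduced; its unmarked letters multiply to
  the inverse of \<open>p\<close>.\<close>

fun mword :: "letter list \<Rightarrow> (nat \<times> letter list) list \<Rightarrow> (letter \<times> bool) list" where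
  "mword p [] = map (\<lambda>x. (x, False)) (red (winv p))"
| "mword p (c # cs) =
     map (\<lambda>x. (x, False)) (red (winv p @ snd c)) @ ((fst c, True), True) # mword (snd c) cs"

abbreviation letters :: "(letter \<times> bool) list \<Rightarrow> letter list" where
  "letters \<equiv> map fst"

abbreviation unmarked :: "(letter \<times> bool) list \<Rightarrow> letter list" where
  "unmarked m \<equiv> map fst (filter (\<lambda>x. \<not> snd x) m)"

lemma filter_unmarked [simp]: "filter (\<lambda>x. \<not> snd x) (map (\<lambda>x. (x, False)) w) = map (\<lambda>x. (x, False)) w"
  by (induction w) auto

text \<open>The unmarked blocks \<open>p^-1 u_1\<close>, \<open>u_1^-1 u_2\<close>, ...,
  \<open>u_k^-1\<close> telescope.\<close>

lemma cl_unmarked_mword: "cl (unmarked (mword p cs)) = - cl p"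
  by (induction p cs rule: mword.induct) (auto simp: cl_append cl_winv o_def grp_simps)

lemma cl_letters_mword: "cl (letters (mword p cs)) = - cl p + sum_list (map cval cs)"
proof (induction p cs rule: mword.induct)
  case (2 p c cs)
  then show ?case
    by (simp add: o_def cl_append cl_Cons[of "(fst c, True)" "map _ _"] cl_winv cval_def grp_simps)
qed (simp add: o_def cl_winv)

text \<open>Used to exclude a mark on the middle letter of an inverse conjugate, which is a negative
  letter.\<close>

lemma mark_positive: "m \<in> set (mword p cs) \<Longrightarrow> snd m \<Longrightarrow> snd (fst m)"
  by (induction p cs rule: mword.induct) auto

lemma unmarked_prefix:
  assumes "map (\<lambda>x. (x, False)) w @ Z = X @ (t, True) # Y"
  shows "\<exists>X'. X = map (\<lambda>x. (x, False)) w @ X' \<and> Z = X' @ (t, True) # Y"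
  using assms
proof (induction w arbitrary: X)
  case (Cons x w)
  then show ?case by (cases X) auto
qed simp

text \<open>Reading up to a mark telescopes to the preceding conjugates followed by
  \<open>u\<close>. So when the conjugate at the mark is moved past its predecessors, its new
  conjugating word can be read off from the prefix \<open>X\<close>.\<close>

lemma mword_split_at_mark:
  assumes "mword p cs = X @ (t, True) # Y"
  shows "\<exists>cs1 b u cs2. cs = cs1 @ (b, u) # cs2 \<and> t = (b, True)
           \<and> cl p + cl (letters X) = sum_list (map cval cs1) + cl u"
  using assms
proof (induction p cs arbitrary: X rule: mword.induct)
  case (1 p)
  then have "(t, True) \<in> set (map (\<lambda>x. (x, False)) (red (winv p)))" by (metis in_set_conv_decomp mword.simps(1))
  then show ?case by auto
next
  case (2 p c cs)
  let ?w = "red (winv p @ snd c)"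
  from "2.prems" obtain X' where X': "X = map (\<lambda>x. (x, False)) ?w @ X'"
    "((fst c, True), True) # mword (snd c) cs = X' @ (t, True) # Y"
    using unmarked_prefix[of ?w "((fst c, True), True) # mword (snd c) cs" X t Y] by auto
  show ?case
  proof (cases X')
    case Nil
    with X' show ?thesis
      by (intro exI[of _ "[]"] exI[of _ "fst c"] exI[of _ "snd c"] exI[of _ cs])
         (simp add: o_def cl_append cl_winv)
  next
    case (Cons y X'')
    with X' have "mword (snd c) cs = X'' @ (t, True) # Y" by simp
    from "2.IH"[OF this] obtain cs1 b u cs2 where IH: "cs = cs1 @ (b, u) # cs2" "t = (b, True)"
      "cl (snd c) + cl (letters X'') = sum_list (map cval cs1) + cl u" by blast
    have "cl (letters X'') = - cl (snd c) + (sum_list (map cval cs1) + cl u)"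
      by (simp flip: IH(3))
    moreover have "fst y = (fst c, True)" using Cons X'(2) by auto
    ultimately have "cl p + cl (letters X) = sum_list (map cval (c # cs1)) + cl u"
      by (simp add: X'(1) Cons o_def cl_append cl_winv cl_Cons[of "(fst c, True)" "letters X''"] cval_def grp_simps)
    then show ?thesis
      using IH(1,2) by (intro exI[of _ "c # cs1"] exI[of _ b] exI[of _ u] exI[of _ cs2]) simp
  qed
qed

text \<open>The form reached when the total length is minimal: any loose pair of neighbours would
  allow a shortening Hurwitz move.\<close>

abbreviation settled :: "(nat \<times> letter list) list \<Rightarrow> bool" where
  "settled cs \<equiv> (\<forall>c\<in>set cs. tight c) \<and>
     successively (\<lambda>c d. \<not> loose_left c d \<and> \<not> loose_right c d) cs"

text \<open>The middle letter of \<open>c\<close> is kept in front so that the induction sees its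
  junction with the next block. \<open>settled\<close> excludes cancellation at both ends of a
  nonempty block; around an empty block two positive letters meet.\<close>

lemma reduced_mword_Cons:
  assumes "settled (c # cs)"
  shows "reduced ((fst c, True) # letters (mword (snd c) cs))"
  using assms
proof (induction cs arbitrary: c)
  case Nil
  then show ?case
    by (auto simp: tight_def o_def red_eq reduced_append)
next
  case (Cons d cs)
  let ?s = "red (winv (snd c) @ snd d)"
  have IH: "reduced ((fst d, True) # letters (mword (snd d) cs))"
    using Cons by auto
  have s: "?s \<noteq> [] \<Longrightarrow> hd ?s \<noteq> (fst c, False)" "?s \<noteq> [] \<Longrightarrow> last ?s \<noteq> (fst d, False)"
    using Cons.prems by (auto simp: loose_left_def loose_right_def Let_def)
  have l: "?s \<noteq> [] \<Longrightarrow> linv (last ?s) \<noteq> (fst d, True)"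
    using s(2) by (metis linv_Pair linv_linv not_True_eq_False)
  have "reduced (?s @ (fst d, True) # letters (mword (snd d) cs))"
    using IH l by (auto simp: reduced_append)
  then have "reduced ((fst c, True) # ?s @ (fst d, True) # letters (mword (snd d) cs))"
    using s(1) by (subst reduced_Cons) (auto simp: hd_append)
  then show ?case by (simp add: o_def)
qed

lemma reduced_mword:
  assumes "settled cs"
  shows "reduced (letters (mword [] cs))"
proof (cases cs)
  case (Cons c cs')
  with assms reduced_mword_Cons[of c cs']
  have "reduced ((fst c, True) # letters (mword (snd c) cs'))" by simp
  moreover from Cons assms have "tight c" by simp
  then have "reduced (snd c @ [(fst c, True)])"
    by (auto simp: tight_def reduced_append)
  ultimately show ?thesis
    by (auto simp: Cons o_def red_eq reduced_append)
qed simp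

section \<open>Existence of useful marks\<close>

abbreviation tword :: "nat \<Rightarrow> nat \<Rightarrow> letter list" where
  "tword i n \<equiv> map (\<lambda>k. (k, True)) [i..<Suc n]"

declare upt_Suc [simp del]

lemma reduced_tword: "reduced (tword i n)"
  by (rule reduced_if_positive) auto

lemma conj_cval: "h + cval (b, u) + - h = h + cl u + tg b + - (h + cl u)"
  by (simp add: cval_def grp_simps)

text \<open>Passing to the normal form strips only trailing letters of index \<open>b\<close>. So
  the first letter of \<open>g\<close> survives unless all of \<open>g\<close> is stripped, and then
  \<open>B = t_b\<close>.\<close>

lemma rep_conj_subword:
  assumes "reduced g" "B = cval (b, g)"
  shows "length (rep B) \<le> 2 * length g + 1"
    and "B = tg b \<and> fst ` set g \<subseteq> {b} \<or> g \<noteq> [] \<and> hd (rep B) = hd g"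
proof -
  show "length (rep B) \<le> 2 * length g + 1"
    using length_rep_cval_le assms by simp
  obtain u v where uv: "g = u @ v" "fst ` set v \<subseteq> {b}" "tight (b, u)" "cval (b, g) = cval (b, u)"
    using conj_normal_form[OF assms(1)] by metis
  then show "B = tg b \<and> fst ` set g \<subseteq> {b} \<or> g \<noteq> [] \<and> hd (rep B) = hd g"
    using assms(2) rep_cval[OF uv(3)] by (cases u) (auto simp: cval_def[of "(_, [])"])
qed

lemma map_eq_appendE:
  assumes "map f xs = u @ v"
  obtains us vs where "xs = us @ vs" "map f us = u" "map f vs = v"
  using assms by (auto simp: map_eq_append_conv)

text \<open>\<open>B\<close> is the image of \<open>t_i\<close> after the chosen conjugate has been
  moved to position \<open>i + 1\<close> and \<open>\<sigma>_i^-1\<close> has been applied on the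
  left. A mark must lie in the part \<open>p^-1 t_i\<close> of the reduced word: otherwise its
  unmarked letters are too many to multiply to 1 with those of \<open>p\<close>.\<close>

lemma mark_after_middle:
  assumes settled: "settled cs" and tight: "tight (a, p)" and "i \<le> n"
    and sum: "sum_list (map cval cs) = - cval (a, p) + cl (tword i n)"
    and hd: "hd (rep (cval (a, p))) \<noteq> (i, True)"
  obtains cs1 b u cs2 where "cs = cs1 @ (b, u) # cs2"
    "let h = cval (a, p) + sum_list (map cval cs1); B = h + cval (b, u) + - h
     in B = tg i \<or> length (rep B) < length (rep (cval (a, p))) \<and> hd (rep B) \<noteq> (i, True)"
proof -
  define A where "A = cval (a, p)"
  have repA: "rep A = p @ (a, True) # winv p"
    using tight by (simp add: A_def rep_cval)
  have hdA: "hd (rep A) \<noteq> (i, True)"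
    using hd by (simp add: A_def)
  define T where "T = tword (Suc i) n"
  have T: "tword i n = (i, True) # T"
    using \<open>i \<le> n\<close> by (simp add: T_def upt_conv_Cons)
  define M where "M = mword [] cs"
  have A': "- A = cl (p @ (a, False) # winv p)"
    by (simp add: A_def cval_def cl_append cl_Cons[of "(a, False)" "winv p"] cl_winv grp_simps)
  have redA': "reduced (p @ (a, False) # winv p)"
    using tight reduced_winv[of "p @ (a, True) # winv p"]
    by (simp add: tight_def winv_Cons del: reduced_winv)
  \<comment> \<open>\<open>A\<close> does not start with \<open>t_i\<close>, so \<open>A^-1\<close>
    does not end with \<open>t_i^-1\<close>, and nothing cancels at the junction.\<close>
  moreover have "last (p @ (a, False) # winv p) \<noteq> (i, False)"
    using hdA by (cases "p = []") (auto simp: repA last_winv hd_append linv_def prod_eq_iff)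
  ultimately have redW: "reduced ((p @ (a, False) # winv p) @ (i, True) # T)"
    using reduced_tword[of i n] unfolding T
    by (subst reduced_append) (auto simp: linv_def prod_eq_iff)
  have "cl (letters M) = cl ((p @ (a, False) # winv p) @ (i, True) # T)"
    by (simp only: M_def cl_letters_mword sum cl_append[of _ "(i, True) # T"] A'[symmetric])
       (simp add: A_def T)
  then have "letters M = p @ (a, False) # winv p @ (i, True) # T"
    using cl_inject[OF reduced_mword[OF settled] redW] by (simp add: M_def)
  then obtain M1 m2 M3 m4 M5 where M: "M = M1 @ m2 # M3 @ m4 # M5" "letters M1 = p" "fst m2 = (a, False)"
     "letters M3 = winv p" "fst m4 = (i, True)" "letters M5 = T"
  proof -
    assume *: "\<And>M1 m2 M3 m4 M5. M = M1 @ m2 # M3 @ m4 # M5 \<Longrightarrow> letters M1 = p \<Longrightarrow> fst m2 = (a, False) \<Longrightarrow>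
      letters M3 = winv p \<Longrightarrow> fst m4 = (i, True) \<Longrightarrow> letters M5 = T \<Longrightarrow> thesis"
    assume "letters M = p @ (a, False) # winv p @ (i, True) # T"
    then obtain M1 N where N: "M = M1 @ N" "letters M1 = p" "letters N = (a, False) # winv p @ (i, True) # T"
      by (rule map_eq_appendE)
    then obtain m2 N' where N': "N = m2 # N'" "fst m2 = (a, False)" "letters N' = winv p @ (i, True) # T"
      unfolding map_eq_Cons_conv by metis
    from N'(3) obtain M3 N'' where N'': "N' = M3 @ N''" "letters M3 = winv p" "letters N'' = (i, True) # T"
      by (rule map_eq_appendE)
    then obtain m4 M5 where "N'' = m4 # M5" "fst m4 = (i, True)" "letters M5 = T"
      unfolding map_eq_Cons_conv by metis
    with N N' N'' show thesis by (intro *[of M1 m2 M3 m4 M5]) simp_all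
  qed
  have splitM: "- A + cl (tword i n) = cl (letters M)"
    by (simp add: M_def cl_letters_mword sum A_def)
  consider (inner) X3 t Y3 where "M3 = X3 @ (t, True) # Y3" | (first) "snd m4"
    | (none) "\<forall>m\<in>set M3. \<not> snd m" "\<not> snd m4"
    by (metis (full_types) prod.collapse split_list)
  then show thesis
  proof cases
    case inner
    define X where "X = M1 @ m2 # X3"
    have "M = X @ (t, True) # Y3 @ m4 # M5" by (simp add: M inner X_def)
    from mword_split_at_mark[OF this[unfolded M_def]] obtain cs1 b u cs2 where
      cs: "cs = cs1 @ (b, u) # cs2" "t = (b, True)" "cl (letters X) = sum_list (map cval cs1) + cl u"
      by auto
    define y where "y = letters Y3"
    have wp: "winv p = letters X3 @ (b, True) # y"
      using M(4) inner cs(2) by (simp add: y_def)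
    then have "p = winv (letters X3 @ (b, True) # y)" by (metis winv_winv)
    then have p: "p = winv y @ (b, False) # winv (letters X3)" by (simp add: winv_Cons)
    have "letters M = letters X @ (b, True) # y @ tword i n"
      by (simp add: M inner X_def y_def cs(2) T)
    with splitM have "- A + cl (tword i n) = cl (letters X) + tg b + cl y + cl (tword i n)"
      by (simp add: cl_append cl_Cons[of "(b, True)" "y @ _"] grp_simps)
    then have "- A = cl (letters X) + tg b + cl y" by simp
    then have "A = - (cl (letters X) + tg b + cl y)" by (metis add.inverse_inverse)
    then have hX: "A + cl (letters X) = - cl y + - tg b"
      by (simp add: grp_simps)
    define h where "h = A + sum_list (map cval cs1)"
    have hu: "h + cl u = - cl y + - tg b"
      by (simp add: h_def add.assoc cs(3)[symmetric] hX)
    define B where "B = h + cval (b, u) + - h"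
    \<comment> \<open>The conjugating word \<open>y^-1 t_b^-1\<close> loses its last letter, which
      commutes with \<open>t_b\<close>; the remaining \<open>y^-1\<close> is a proper prefix of
      \<open>p\<close>.\<close>
    have "B = cval (b, winv y)"
      by (simp only: B_def conj_cval hu) (simp add: cval_def cl_winv grp_simps)
    moreover have "reduced p" using tight by (simp add: tight_iff)
    then have "reduced (winv y)" by (simp add: p reduced_append del: reduced_winv)
    ultimately have B: "length (rep B) \<le> 2 * length (winv y) + 1"
      "B = tg b \<and> fst ` set (winv y) \<subseteq> {b} \<or> winv y \<noteq> [] \<and> hd (rep B) = hd (winv y)"
      using rep_conj_subword by metis+
    have "length (rep B) < length (rep A)" using B(1) by (simp add: repA p)
    moreover have "B = tg i \<or> hd (rep B) \<noteq> (i, True)"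
    proof (cases "winv y \<noteq> [] \<and> hd (rep B) = hd (winv y)")
      case True
      then show ?thesis using hdA by (auto simp: repA p hd_append split: if_splits)
    next
      case False
      with B(2) have "B = tg b" by blast
      then show ?thesis by auto
    qed
    ultimately show thesis
      using that[OF cs(1)] by (auto simp: Let_def B_def h_def A_def)
  next
    case first
    define X where "X = M1 @ m2 # M3"
    have "M = X @ ((i, True), True) # M5" using M(5) first by (cases m4) (simp add: M X_def)
    from mword_split_at_mark[OF this[unfolded M_def]] obtain cs1 b u cs2 where
      cs: "cs = cs1 @ (b, u) # cs2" "b = i" "cl (letters X) = sum_list (map cval cs1) + cl u"
      by auto
    have "letters M = letters X @ tword i n"
      by (simp add: M X_def T)
    \<comment> \<open>With a mark on \<open>t_i\<close>, exactly \<open>A^-1\<close> precedes it, so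
      the conjugating word becomes trivial and \<open>B = t_i\<close>.\<close>
    with splitM have "- A = cl (letters X)" by (simp add: cl_append)
    then have "A + cl (letters X) = 0" by (metis add.right_inverse)
    then have hu: "(A + sum_list (map cval cs1)) + cl u = 0"
      by (simp add: cs(3) add.assoc)
    show thesis
      by (rule that[OF cs(1)]) (simp only: Let_def A_def[symmetric] conj_cval hu cs(2), simp)
  next
    case none
    \<comment> \<open>All \<open>length p + 2\<close> letters of \<open>F\<close> are unmarked here,
      and the positive letters after it cannot cancel with its end. At most \<open>length p\<close>
      unmarked letters precede \<open>F\<close>, too few to multiply with the rest to 1.\<close>
    define F where "F = (a, False) # winv p @ [(i, True)]"
    have "m2 \<in> set M" by (simp add: M)
    then have "\<not> snd m2"
      using M(3) mark_positive[of m2 "[]" cs] by (auto simp: M_def[symmetric])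
    moreover have "filter (\<lambda>x. \<not> snd x) M3 = M3" using none by (simp add: filter_id_conv)
    ultimately have "unmarked M = unmarked M1 @ F @ unmarked M5"
      using none M by (simp add: F_def)
    then have "cl (unmarked M1) + cl (F @ unmarked M5) = 0"
      using cl_unmarked_mword[of "[]" cs] by (simp add: M_def[symmetric] cl_append)
    then have "- cl (unmarked M1) = cl (F @ unmarked M5)"
      using minus_unique by blast
    then have "cl (F @ unmarked M5) = cl (winv (unmarked M1))" by (simp add: cl_winv)
    moreover have "reduced (F @ unmarked M5)"
    proof -
      have "set (unmarked M5) \<subseteq> set (letters M5)" by auto
      moreover have "\<forall>x\<in>set (letters M5). snd x" unfolding M(6) T_def by auto
      ultimately have pos: "\<forall>x\<in>set (unmarked M5). snd x" by blast
      have "reduced F"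
        using redW by (auto simp: F_def reduced_append reduced_Cons hd_append split: if_splits)
      moreover have "unmarked M5 \<noteq> [] \<Longrightarrow> hd (unmarked M5) \<noteq> linv (last F)"
        using pos by (metis F_def hd_in_set last.simps last_append last_snoc linv_Pair list.distinct(1) snd_conv snoc_eq_iff_butlast not_True_eq_False)
      ultimately show ?thesis
        using reduced_if_positive[OF pos] by (auto simp: reduced_append)
    qed
    ultimately have "length (F @ unmarked M5) \<le> length (winv (unmarked M1))"
      using length_le_if_cl_eq by blast
    moreover have "length (unmarked M1) \<le> length p"
      using M(2) by (metis length_filter_le length_map)
    ultimately show thesis by (simp add: F_def)
  qed
qed

lemma reduced_cancellation:
  assumes "reduced a" "reduced b"
  obtains r s t where "a = r @ winv s" "b = s @ t" "reduced (r @ t)"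
proof -
  have "\<exists>r s t. a = r @ winv s \<and> b = s @ t \<and> reduced (r @ t)"
    using assms
  proof (induction b arbitrary: a)
    case Nil
    then show ?case by (intro exI[of _ a] exI[of _ "[]"]) simp
  next
    case (Cons x b)
    show ?case
    proof (cases "a \<noteq> [] \<and> last a = linv x")
      case True
      then obtain a' where a': "a = a' @ [linv x]" by (metis append_butlast_last_id)
      with Cons obtain r s t where "a' = r @ winv s" "b = s @ t" "reduced (r @ t)"
        by (meson reduced_Cons reduced_append)
      then show ?thesis
        by (intro exI[of _ r] exI[of _ "x # s"] exI[of _ t]) (simp add: a' winv_Cons)
    next
      case False
      with Cons.prems have "reduced (a @ x # b)"
        by (auto simp: reduced_append)
      then show ?thesis
        by (intro exI[of _ a] exI[of _ "[]"] exI[of _ "x # b"]) simp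
    qed
  qed
  with that show thesis by blast
qed

text \<open>Here \<open>B\<close> is just the moved conjugate, since \<open>\<sigma>_i\<close>
  copies entry \<open>i + 1\<close> to position \<open>i\<close>. Now \<open>A^-1\<close> ends in
  \<open>t_i^-1\<close> and part of it cancels against \<open>t_i ... t_n\<close>, but
  \<open>p\<close> survives and must carry a mark.\<close>

lemma mark_before_middle:
  assumes settled: "settled cs" and tight: "tight (a, p)"
    and sum: "sum_list (map cval cs) = - cval (a, p) + cl (tword i n)"
    and p: "p \<noteq> []" "hd p = (i, True)"
  obtains cs1 b u cs2 where "cs = cs1 @ (b, u) # cs2"
    "let h = sum_list (map cval cs1); B = h + cval (b, u) + - h
     in B = tg i \<or> length (rep B) < length (rep (cval (a, p))) \<and> hd (rep B) = (i, True)"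
proof -
  define A where "A = cval (a, p)"
  have repA: "rep A = p @ (a, True) # winv p"
    using tight by (simp add: A_def rep_cval)
  have A': "- A = cl (p @ (a, False) # winv p)"
    by (simp add: A_def cval_def cl_append cl_Cons[of "(a, False)" "winv p"] cl_winv grp_simps)
  have redA': "reduced (p @ (a, False) # winv p)"
    using tight reduced_winv[of "p @ (a, True) # winv p"]
    by (simp add: tight_def winv_Cons del: reduced_winv)
  obtain r s t where rst: "p @ (a, False) # winv p = r @ winv s" "tword i n = s @ t" "reduced (r @ t)"
    using reduced_cancellation[OF redA' reduced_tword] by metis
  define M where "M = mword [] cs"
  have "cl (letters M) = cl (r @ winv s) + cl (s @ t)"
    by (simp only: M_def cl_letters_mword sum rst(1,2)[symmetric] A'[symmetric]) (simp add: A_def)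
  then have "cl (letters M) = cl (r @ t)"
    by (simp add: cl_append cl_winv grp_simps)
  then have lM: "letters M = r @ t"
    using cl_inject[OF reduced_mword[OF settled] rst(3)] by (simp add: M_def)
  have pos: "\<forall>x\<in>set s. snd x" "\<forall>x\<in>set t. snd x"
  proof -
    have "\<forall>x\<in>set (s @ t). snd x" by (simp flip: rst(2))
    then show "\<forall>x\<in>set s. snd x" "\<forall>x\<in>set t. snd x" by auto
  qed
  \<comment> \<open>The cancelled end \<open>s^-1\<close> of \<open>A^-1\<close> has only negative
    letters. If it includes the middle letter, then \<open>p^-1\<close> is negative, so
    \<open>p\<close> is positive and the cancellation stops right after \<open>p\<close>.\<close>
  consider (long) "r = p" "\<forall>x\<in>set p. snd x" | (short) v where "r = p @ (a, False) # v" "length v \<le> length p"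
  proof -
    have neg: "\<forall>x\<in>set (winv s). \<not> snd x" using pos(1) by (auto simp: winv_def)
    from rst(1) consider q where "p @ q = r" "(a, False) # winv p = q @ winv s"
      | q where "p = r @ q" "q @ (a, False) # winv p = winv s"
      by (auto simp: append_eq_append_conv2)
    then show thesis
    proof cases
      case 1
      show thesis
      proof (cases q)
        case Nil
        with 1(2) have "\<forall>x\<in>set (winv p). \<not> snd x" using neg by (metis append_Nil list.set_intros(2))
        then have "\<forall>x\<in>set p. snd x" by (auto simp: winv_def)
        with 1 Nil long show thesis by simp
      next
        case (Cons y v)
        with 1(2) have "winv p = v @ winv s" "y = (a, False)" by auto
        then have "length v \<le> length p" by (metis length_winv length_append le_add1)
        with 1 Cons \<open>y = _\<close> show thesis by (intro short[of v]) auto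
      qed
    next
      case 2
      then have *: "\<forall>x\<in>set q. \<not> snd x" "\<forall>x\<in>set (winv p). \<not> snd x"
        using neg by (auto simp flip: 2(2))
      then have pp: "\<forall>x\<in>set p. snd x" by (auto simp: winv_def)
      with * 2(1) have "q = []" by (cases q) auto
      with 2 pp long show thesis by simp
    qed
  qed
  then obtain R where R: "r = p @ R"
    "R = [] \<and> (\<forall>x\<in>set p. snd x) \<or> (\<exists>v. R = (a, False) # v \<and> length v \<le> length p)"
    by cases auto
  obtain M1 M2 M3 where M: "M = M1 @ M2 @ M3" "letters M1 = p" "letters M2 = R" "letters M3 = t"
  proof -
    assume *: "\<And>M1 M2 M3. M = M1 @ M2 @ M3 \<Longrightarrow> letters M1 = p \<Longrightarrow> letters M2 = R \<Longrightarrow> letters M3 = t \<Longrightarrow> thesis"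
    from lM have "letters M = p @ R @ t" by (simp add: R(1))
    then obtain M1 N where N: "M = M1 @ N" "letters M1 = p" "letters N = R @ t"
      by (rule map_eq_appendE)
    from N(3) obtain M2 M3 where "N = M2 @ M3" "letters M2 = R" "letters M3 = t"
      by (rule map_eq_appendE)
    with N show thesis by (intro *[of M1 M2 M3]) simp_all
  qed
  have zero: "cl (unmarked M1) + cl (unmarked M2) + cl (unmarked M3) = 0"
    using cl_unmarked_mword[of "[]" cs] by (simp add: M_def[symmetric] M cl_append grp_simps)
  have "set (unmarked M3) \<subseteq> set (letters M3)" by auto
  then have pos3: "\<forall>x\<in>set (unmarked M3). snd x" using pos(2) unfolding M(4) by blast
  show thesis
  proof (cases "\<exists>x. (x, True) \<in> set M1")
    case True
    then obtain X c Y where X: "M1 = X @ (c, True) # Y" by (metis split_list)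
    then have "M = X @ (c, True) # Y @ M2 @ M3" by (simp add: M)
    from mword_split_at_mark[OF this[unfolded M_def]] obtain cs1 b u cs2 where
      cs: "cs = cs1 @ (b, u) # cs2" "c = (b, True)" "cl (letters X) = sum_list (map cval cs1) + cl u"
      by auto
    define x where "x = letters X"
    have px: "p = x @ (b, True) # letters Y" using M(2) X cs(2) by (auto simp: x_def)
    define h where "h = sum_list (map cval cs1)"
    define B where "B = h + cval (b, u) + - h"
    \<comment> \<open>The conjugating word is the part of \<open>p\<close> before the mark.\<close>
    have "B = cval (b, x)"
      by (simp only: B_def conj_cval h_def cs(3)[symmetric]) (simp add: cval_def x_def)
    moreover have "reduced x" using tight by (simp add: tight_iff px reduced_append)
    ultimately have B: "length (rep B) \<le> 2 * length x + 1"
      "B = tg b \<and> fst ` set x \<subseteq> {b} \<or> x \<noteq> [] \<and> hd (rep B) = hd x"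
      using rep_conj_subword by metis+
    have "length (rep B) < length (rep A)" using B(1) by (simp add: repA px)
    \<comment> \<open>If \<open>B = t_b\<close> with \<open>x\<close> nonempty, its first letter
      \<open>t_i\<close> has index \<open>b\<close>. If \<open>x\<close> is empty, then
      \<open>t_b\<close> is the first letter of \<open>p\<close>. Either way
      \<open>b = i\<close>.\<close>
    moreover have "B = tg i \<or> hd (rep B) = (i, True)"
      using B(2) p(2) by (cases x) (auto simp: px)
    ultimately show thesis
      using that[OF cs(1)] by (auto simp: Let_def B_def h_def A_def)
  next
    case False
    then have "filter (\<lambda>x. \<not> snd x) M1 = M1" by (force simp: filter_id_conv)
    then have M1: "unmarked M1 = p" using M(2) by simp
    have hdp: "unmarked M3 \<noteq> [] \<Longrightarrow> hd p \<noteq> linv (last (unmarked M3))"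
      using pos3 p(2) by (metis last_in_set snd_conv snd_linv)
    from R(2) show thesis
    proof (elim disjE conjE exE)
      assume "R = []" and pp: "\<forall>x\<in>set p. snd x"
      then have "cl (p @ unmarked M3) = 0"
        using zero M(3) by (simp add: M1 cl_append)
      \<comment> \<open>A word of positive letters is reduced and represents 1 only if it is
        empty.\<close>
      moreover have "reduced (p @ unmarked M3)"
        using pp pos3 by (intro reduced_if_positive) (simp only: set_append, blast)
      ultimately have "p @ unmarked M3 = []"
        using cl_inject[of "p @ unmarked M3" "[]"] by simp
      with p(1) show thesis by simp
    next
      fix v assume v: "R = (a, False) # v" "length v \<le> length p"
      then obtain m M2' where M2: "M2 = m # M2'" "fst m = (a, False)" "letters M2' = v"
        using M(3) by (auto simp: map_eq_Cons_conv)
      have "m \<in> set M" by (simp add: M M2)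
      then have "\<not> snd m"
        using M2(2) mark_positive[of m "[]" cs] by (auto simp: M_def[symmetric])
      then have "cl (p @ [(a, False)]) + cl (unmarked M2') + cl (unmarked M3) = 0"
        using zero by (simp add: M1 M2 cl_append cl_Cons[of "(a, False)" "unmarked M2'"] grp_simps)
      then have "cl (unmarked M3) = - (cl (p @ [(a, False)]) + cl (unmarked M2'))"
        using minus_unique by metis
      \<comment> \<open>Rotating the relation puts the positive letters of \<open>M3\<close> in
        front of \<open>p\<close>, which begins with the positive letter \<open>t_i\<close>. So
        \<open>M3\<close>, \<open>p\<close> and the middle letter form a reduced word that is longer
        than \<open>v\<close>.\<close>
      then have "cl (unmarked M3) + cl (p @ [(a, False)]) + cl (unmarked M2') = 0"
        by (simp add: add.assoc)
      then have "cl (unmarked M3 @ p @ [(a, False)]) = cl (winv (unmarked M2'))"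
        by (simp add: cl_append cl_winv eq_neg_iff_add_eq_0 grp_simps)
      moreover have "reduced (p @ [(a, False)])"
        using redA' by (simp add: reduced_append reduced_Cons)
      then have "reduced (unmarked M3 @ p @ [(a, False)])"
        using hdp p(1) reduced_if_positive[OF pos3] by (subst reduced_append) (auto simp: hd_append)
      ultimately have "length (unmarked M3 @ p @ [(a, False)]) \<le> length (winv (unmarked M2'))"
        using length_le_if_cl_eq by blast
      moreover have "length (unmarked M2') \<le> length v"
        using M2(3) by (metis length_filter_le length_map)
      ultimately show thesis using v(2) by simp
    qed
  qed
qed

section \<open>Homomorphisms determined by the images of the generators\<close>

text \<open>The homomorphism that sends \<open>t_k\<close> to \<open>F k\<close>, evaluated on
  arbitrary words; \<open>ev_red\<close> shows that it is well defined on the free group.\<close>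

definition ev :: "(nat \<Rightarrow> fgrp) \<Rightarrow> letter list \<Rightarrow> fgrp" where
  "ev F w = sum_list (map (\<lambda>x. if snd x then F (fst x) else - F (fst x)) w)"

lemma ev_Nil [simp]: "ev F [] = 0"
  by (simp add: ev_def)

lemma ev_Cons: "ev F (x # w) = (if snd x then F (fst x) else - F (fst x)) + ev F w"
  by (simp add: ev_def)

lemma ev_append: "ev F (u @ v) = ev F u + ev F v"
  by (simp add: ev_def)

lemma ev_winv: "ev F (winv w) = - ev F w"
  by (induction w) (auto simp: winv_Cons ev_append ev_Cons grp_simps)

lemma ev_red [simp]: "ev F (red w) = ev F w"
proof (induction w)
  case (Cons x w)
  show ?case
  proof (cases "red w")
    case Nil
    with Cons show ?thesis by (simp add: ev_Cons)
  next
    case (Cons y ys)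
    with Cons.IH have "ev F w = ev F (y # ys)" by simp
    with Cons show ?thesis by (auto simp: ev_Cons)
  qed
qed simp

lemma ev_tg: "ev tg w = cl w"
proof (induction w)
  case (Cons x w)
  then show ?case by (simp add: ev_Cons cl_Cons[of x w] cl_letter[of x])
qed simp

lemma ev_cong: "(\<And>k. k \<in> fst ` set w \<Longrightarrow> F k = G k) \<Longrightarrow> ev F w = ev G w"
  by (induction w) (auto simp: ev_Cons)

lemma ev_tword: "ev F (tword i n) = sum_list (map F [i..<Suc n])"
  by (simp add: ev_def o_def)

lemma ev_rep_add: "ev F (rep (g + h)) = ev F (rep g) + ev F (rep h)"
  by (simp add: plus_fgrp_def ev_append)

lemma ev_rep_uminus: "ev F (rep (- g)) = - ev F (rep g)"
  by (simp add: uminus_fgrp_def ev_winv)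

lemma ev_rep_ev: "ev G (rep (ev F w)) = ev (\<lambda>k. ev G (rep (F k))) w"
  by (induction w) (auto simp: ev_Cons ev_rep_add ev_rep_uminus)

lemma ext_hom_eq: "ext_hom f w = rep (ev (\<lambda>k. cl (f k)) w)"
proof -
  have "cl (concat (map (\<lambda>x. if snd x then f (fst x) else winv (f (fst x))) w)) = ev (\<lambda>k. cl (f k)) w"
    by (induction w) (auto simp: ev_Cons cl_append cl_winv)
  then show ?thesis by (metis ext_hom_def rep_cl)
qed

section \<open>The groups \<open>FG n\<close> and their endomorphisms\<close>

abbreviation FC :: "nat \<Rightarrow> letter list set" where
  "FC n \<equiv> carrier (FG n)"

lemma FC_iff: "w \<in> FC n \<longleftrightarrow> reduced w \<and> fst ` set w \<subseteq> {1..n}"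
  by (auto simp: FG_def)

lemma mult_FG [simp]: "u \<otimes>\<^bsub>FG n\<^esub> v = red (u @ v)"
  by (simp add: FG_def)

lemma red_in_FC: "fst ` set w \<subseteq> {1..n} \<Longrightarrow> red w \<in> FC n"
  using set_red[of w] by (auto simp: FC_iff)

lemma FC_mult: "u \<in> FC n \<Longrightarrow> v \<in> FC n \<Longrightarrow> red (u @ v) \<in> FC n"
  by (rule red_in_FC) (auto simp: FC_iff)

lemma FC_winv: "u \<in> FC n \<Longrightarrow> winv u \<in> FC n"
  by (simp add: FC_iff fst_set_winv)

lemma FC_conj: "g \<in> FC n \<Longrightarrow> x \<in> FC n \<Longrightarrow> red (g @ x @ winv g) \<in> FC n"
  using FC_mult[of "red (g @ x)" n "winv g"] by (simp add: FC_mult FC_winv)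

lemma FC_Nil [simp]: "[] \<in> FC n"
  by (simp add: FC_iff)

lemma FC_Cons: "x # w \<in> FC n \<Longrightarrow> [x] \<in> FC n \<and> w \<in> FC n"
  by (auto simp: FC_iff reduced_Cons)

lemma gen_in_FC: "k \<in> {1..n} \<Longrightarrow> gen k \<in> FC n"
  by (simp add: FC_iff gen_def)

lemma z1_eq: "z1 n = winv (tword 1 n)"
  by (simp add: z1_def)

lemma z1_in_FC: "z1 n \<in> FC n"
  unfolding z1_eq by (rule FC_winv) (auto simp: FC_iff reduced_tword)

lemma cl_gen [simp]: "cl (gen k) = tg k"
  by (simp add: gen_def)

abbreviation gimg :: "(letter list \<Rightarrow> letter list) \<Rightarrow> nat \<Rightarrow> fgrp" where
  "gimg \<phi> k \<equiv> cl (\<phi> (gen k))"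

lemma hom_FG_iff:
  "\<phi> \<in> hom (FG n) (FG n) \<longleftrightarrow>
     (\<forall>x\<in>FC n. \<phi> x \<in> FC n) \<and> (\<forall>x\<in>FC n. \<forall>y\<in>FC n. \<phi> (red (x @ y)) = red (\<phi> x @ \<phi> y))"
  by (auto simp: hom_def)

text \<open>A reduced word is the product of its letters, and the image of a negative letter is
  forced by that of the positive one. From here on braids are handled through the tuple of their
  \<open>gimg\<close> values.\<close>

lemma hom_eq_ev:
  assumes "\<phi> \<in> hom (FG n) (FG n)" "w \<in> FC n"
  shows "\<phi> w = rep (ev (gimg \<phi>) w)"
proof -
  note h = assms(1)[unfolded hom_FG_iff]
  have add: "cl (\<phi> (red (x @ y))) = cl (\<phi> x) + cl (\<phi> y)" if "x \<in> FC n" "y \<in> FC n" for x y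
    using h that by (simp add: cl_append)
  have zero: "cl (\<phi> []) = 0"
    using add[of "[]" "[]"] add_left_cancel[of "cl (\<phi> [])" "cl (\<phi> [])" 0] by simp
  have "cl (\<phi> w) = ev (gimg \<phi>) w"
    using assms(2)
  proof (induction w)
    case (Cons x w)
    have C: "[x] \<in> FC n" "w \<in> FC n" using FC_Cons[OF Cons.prems] by auto
    have "red ([x] @ w) = x # w" using Cons.prems by (simp only: FC_iff red_eq append_Cons append_Nil)
    then have "cl (\<phi> (x # w)) = cl (\<phi> [x]) + cl (\<phi> w)" using add[OF C] by metis
    moreover have "cl (\<phi> [x]) = (if snd x then gimg \<phi> (fst x) else - gimg \<phi> (fst x))"
    proof (cases "snd x")
      case True
      then show ?thesis by (cases x) (simp add: gen_def)
    next
      case False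
      then obtain k where x: "x = (k, False)" by (cases x) auto
      have "gen k \<in> FC n" using C(1) by (simp add: x FC_iff gen_def)
      from add[OF this C(1)] have "gimg \<phi> k + cl (\<phi> [x]) = 0"
        by (simp add: x gen_def zero)
      then have "cl (\<phi> [x]) = - gimg \<phi> k" using minus_unique by metis
      then show ?thesis by (simp add: x)
    qed
    ultimately show ?case using Cons.IH[OF C(2)] by (simp add: ev_Cons)
  qed (simp add: zero)
  moreover have "reduced (\<phi> w)" using h assms(2) by (simp add: FC_iff)
  ultimately show ?thesis by (metis red_eq rep_cl)
qed

lemma hom_FG_eqI:
  assumes "\<phi> \<in> hom (FG n) (FG n)" "\<psi> \<in> hom (FG n) (FG n)"
    and "\<phi> \<in> extensional (FC n)" "\<psi> \<in> extensional (FC n)"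
    and "\<And>k. k \<in> {1..n} \<Longrightarrow> gimg \<phi> k = gimg \<psi> k"
  shows "\<phi> = \<psi>"
proof (rule extensionalityI[OF assms(3,4)])
  fix w assume w: "w \<in> FC n"
  have "ev (gimg \<phi>) w = ev (gimg \<psi>) w"
    using w assms(5) by (intro ev_cong) (auto simp: FC_iff)
  then show "\<phi> w = \<psi> w"
    using hom_eq_ev[OF assms(1) w] hom_eq_ev[OF assms(2) w] by simp
qed

lemma hom_conj:
  assumes "\<phi> \<in> hom (FG n) (FG n)" "g \<in> FC n" "x \<in> FC n"
  shows "\<phi> (red (g @ x @ winv g)) = red (\<phi> g @ \<phi> x @ winv (\<phi> g))"
proof -
  have "\<phi> (red (g @ x @ winv g)) = rep (ev (gimg \<phi>) g + ev (gimg \<phi>) x + - ev (gimg \<phi>) g)"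
    using hom_eq_ev[OF assms(1) FC_conj[OF assms(2,3)]] by (simp add: ev_append ev_winv add.assoc)
  also have "\<dots> = rep (cl (\<phi> g) + cl (\<phi> x) + - cl (\<phi> g))"
    using hom_eq_ev[OF assms(1)] assms(2,3) by simp
  also have "\<dots> = rep (cl (\<phi> g @ \<phi> x @ winv (\<phi> g)))"
    by (simp only: cl_append cl_winv add.assoc)
  finally show ?thesis by simp
qed

section \<open>The group \<open>Bn\<close>\<close>

lemma conjclass_subset: "x \<in> FC n \<Longrightarrow> conjclass n x \<subseteq> FC n"
  by (auto simp: conjclass_def FC_conj)

lemma conjclass_conj:
  assumes "g \<in> FC n"
  shows "conjclass n (red (g @ x @ winv g)) = conjclass n x"
proof -
  have 1: "red (h @ red (g @ x @ winv g) @ winv h) = red (red (h @ g) @ x @ winv (red (h @ g)))" for g h x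
    unfolding cl_eq_iff[symmetric] by (simp add: cl_append cl_winv grp_simps)
  have sub: "conjclass n (red (g @ x @ winv g)) \<subseteq> conjclass n x" if "g \<in> FC n" for g x
  proof
    fix w assume "w \<in> conjclass n (red (g @ x @ winv g))"
    then obtain h where "h \<in> FC n" "w = red (red (h @ g) @ x @ winv (red (h @ g)))"
      unfolding conjclass_def 1 by blast
    then show "w \<in> conjclass n x"
      unfolding conjclass_def using FC_mult[OF _ that] by blast
  qed
  \<comment> \<open>The reverse inclusion is the first one, applied to conjugation by
    \<open>g^-1\<close>.\<close>
  have "conjclass n (red (winv g @ red (g @ x @ winv g) @ winv (winv g))) \<subseteq> conjclass n (red (g @ x @ winv g))"
    by (rule sub) (simp add: FC_winv assms)
  moreover have "conjclass n (red (winv g @ red (g @ x @ winv g) @ winv (winv g))) = conjclass n x"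
  proof -
    have "cl (winv g @ red (g @ x @ winv g) @ winv (winv g)) = cl x"
      by (simp add: cl_append cl_winv grp_simps)
    then have "red (h @ red (winv g @ red (g @ x @ winv g) @ winv (winv g)) @ winv h) = red (h @ x @ winv h)" for h
      unfolding cl_eq_iff[symmetric] by (simp add: cl_append cl_winv)
    then show ?thesis by (simp add: conjclass_def)
  qed
  ultimately show ?thesis using sub[OF assms] by blast
qed

text \<open>Because \<open>\<phi>\<close> is onto, the elements \<open>\<phi> g\<close> run through
  all conjugating words.\<close>

lemma image_conjclass:
  assumes "\<phi> \<in> hom (FG n) (FG n)" "\<phi> ` FC n = FC n" "x \<in> FC n"
  shows "\<phi> ` conjclass n x = conjclass n (\<phi> x)"
proof -
  have "\<phi> ` conjclass n x = (\<lambda>g. \<phi> (red (g @ x @ winv g))) ` FC n"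
    by (auto simp: conjclass_def)
  also have "\<dots> = (\<lambda>g. red (\<phi> g @ \<phi> x @ winv (\<phi> g))) ` FC n"
    using hom_conj[OF assms(1) _ assms(3)] by (intro image_cong) auto
  also have "\<dots> = (\<lambda>g. red (g @ \<phi> x @ winv g)) ` \<phi> ` FC n"
    by (simp add: image_image)
  finally show ?thesis using assms(2) by (auto simp: conjclass_def)
qed

abbreviation genclasses :: "nat \<Rightarrow> letter list set set" where
  "genclasses n \<equiv> conjclass n ` gen ` {1..n}"

lemma genclass_subset: "C \<in> genclasses n \<Longrightarrow> C \<subseteq> FC n"
  using conjclass_subset gen_in_FC by blast

lemma BnI:
  assumes "\<phi> \<in> hom (FG n) (FG n)" "bij_betw \<phi> (FC n) (FC n)" "\<phi> \<in> extensional (FC n)"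
    "\<phi> (z1 n) = z1 n" "(\<lambda>C. \<phi> ` C) ` genclasses n = genclasses n"
  shows "\<phi> \<in> Bn n"
  using assms by (simp add: Bn_def iso_def)

lemma BnD:
  assumes "\<phi> \<in> Bn n"
  shows "\<phi> \<in> hom (FG n) (FG n)" "bij_betw \<phi> (FC n) (FC n)" "\<phi> \<in> extensional (FC n)"
    "\<phi> (z1 n) = z1 n" "(\<lambda>C. \<phi> ` C) ` genclasses n = genclasses n"
  using assms by (simp_all add: Bn_def iso_def)

lemma Bn_closed: "\<phi> \<in> Bn n \<Longrightarrow> w \<in> FC n \<Longrightarrow> \<phi> w \<in> FC n"
  using BnD(1) by (simp add: hom_FG_iff)

lemma bone_in_Bn: "bone n \<in> Bn n"
proof (rule BnI)
  show "bone n \<in> hom (FG n) (FG n)"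
    by (simp add: hom_FG_iff bone_def FC_mult)
  show "bij_betw (bone n) (FC n) (FC n)"
    by (rule bij_betwI[of _ _ _ "bone n"]) (auto simp: bone_def)
  show "(\<lambda>C. bone n ` C) ` genclasses n = genclasses n"
  proof -
    have "bone n ` C = C" if "C \<in> genclasses n" for C
      using genclass_subset[OF that] by (force simp: bone_def)
    then show ?thesis by simp
  qed
qed (auto simp: bone_def z1_in_FC)

lemma bcomp_in_Bn:
  assumes "\<phi> \<in> Bn n" "\<psi> \<in> Bn n"
  shows "bcomp n \<phi> \<psi> \<in> Bn n"
proof (rule BnI)
  note \<phi> = BnD[OF assms(1)] and \<psi> = BnD[OF assms(2)]
  show "bcomp n \<phi> \<psi> \<in> hom (FG n) (FG n)"
    using \<phi>(1) \<psi>(1) by (simp add: hom_FG_iff bcomp_def FC_mult)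
  have "bij_betw (\<psi> \<circ> \<phi>) (FC n) (FC n)" using \<phi>(2) \<psi>(2) by (rule bij_betw_trans)
  then show "bij_betw (bcomp n \<phi> \<psi>) (FC n) (FC n)"
    by (rule iffD1[OF bij_betw_cong, rotated]) (simp add: bcomp_def)
  show "bcomp n \<phi> \<psi> (z1 n) = z1 n" using \<phi>(4) \<psi>(4) by (simp add: bcomp_def z1_in_FC)
  have *: "bcomp n \<phi> \<psi> ` C = \<psi> ` \<phi> ` C" if "C \<in> genclasses n" for C
    using genclass_subset[OF that] by (force simp: bcomp_def)
  have "(\<lambda>C. bcomp n \<phi> \<psi> ` C) ` genclasses n = (\<lambda>C. \<psi> ` \<phi> ` C) ` genclasses n"
    by (rule image_cong[OF refl *])
  also have "\<dots> = (\<lambda>C. \<psi> ` C) ` (\<lambda>C. \<phi> ` C) ` genclasses n"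
    by (rule image_image[symmetric])
  finally show "(\<lambda>C. bcomp n \<phi> \<psi> ` C) ` genclasses n = genclasses n"
    using \<phi>(5) \<psi>(5) by simp
qed (simp add: bcomp_def)

lemma binv_apply:
  assumes "\<phi> \<in> Bn n" "w \<in> FC n"
  shows "binv n \<phi> w \<in> FC n" "\<phi> (binv n \<phi> w) = w" "binv n \<phi> (\<phi> w) = w"
proof -
  have b: "inj_on \<phi> (FC n)" "\<phi> ` FC n = FC n" using BnD(2)[OF assms(1)] by (auto simp: bij_betw_def)
  show "binv n \<phi> w \<in> FC n" using inv_into_into[of w \<phi> "FC n"] assms(2) b(2) by (simp add: binv_def)
  show "\<phi> (binv n \<phi> w) = w" using f_inv_into_f[of w \<phi> "FC n"] assms(2) b(2) by (simp add: binv_def)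
  show "binv n \<phi> (\<phi> w) = w" using inv_into_f_f[OF b(1) assms(2)] Bn_closed[OF assms] by (simp add: binv_def)
qed

lemma binv_in_Bn:
  assumes "\<phi> \<in> Bn n"
  shows "binv n \<phi> \<in> Bn n"
proof (rule BnI)
  note \<phi> = BnD[OF assms] and i = binv_apply[OF assms]
  show "binv n \<phi> \<in> hom (FG n) (FG n)"
    unfolding hom_FG_iff
  proof (intro conjI ballI)
    fix x y assume xy: "x \<in> FC n" "y \<in> FC n"
    have "\<phi> (red (binv n \<phi> x @ binv n \<phi> y)) = red (x @ y)"
      using \<phi>(1) i xy by (simp add: hom_FG_iff)
    then show "binv n \<phi> (red (x @ y)) = red (binv n \<phi> x @ binv n \<phi> y)"
      using i(3)[OF FC_mult[OF i(1)[OF xy(1)] i(1)[OF xy(2)]]] by simp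
  qed (simp add: i)
  show "bij_betw (binv n \<phi>) (FC n) (FC n)"
    using i Bn_closed[OF assms] by (intro bij_betwI[of _ _ _ \<phi>]) auto
  show "binv n \<phi> (z1 n) = z1 n" using i(3)[OF z1_in_FC] \<phi>(4) by simp
  have *: "binv n \<phi> ` \<phi> ` C = C" if "C \<in> genclasses n" for C
    using genclass_subset[OF that] i(3) by (force simp: image_image)
  have "(\<lambda>C. binv n \<phi> ` C) ` (\<lambda>C. \<phi> ` C) ` genclasses n = (\<lambda>C. binv n \<phi> ` \<phi> ` C) ` genclasses n"
    by (rule image_image)
  also have "\<dots> = (\<lambda>C. C) ` genclasses n"
    by (rule image_cong[OF refl *])
  finally show "(\<lambda>C. binv n \<phi> ` C) ` genclasses n = genclasses n" using \<phi>(5) by simp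
qed (simp add: binv_def)

section \<open>The group structure of \<open>Bn n\<close> and the images of the generators\<close>

definition BG :: "nat \<Rightarrow> (letter list \<Rightarrow> letter list) monoid" where
  "BG n = \<lparr>carrier = Bn n, mult = bcomp n, one = bone n\<rparr>"

lemma BG_simps [simp]: "carrier (BG n) = Bn n" "mult (BG n) = bcomp n" "one (BG n) = bone n"
  by (simp_all add: BG_def)

lemma bcomp_bone_left: "\<phi> \<in> Bn n \<Longrightarrow> bcomp n (bone n) \<phi> = \<phi>"
  by (rule extensionalityI[of _ "FC n"]) (auto simp: bcomp_def bone_def dest: BnD(3))

lemma bcomp_binv_left: "\<phi> \<in> Bn n \<Longrightarrow> bcomp n (binv n \<phi>) \<phi> = bone n"
  by (rule extensionalityI[of _ "FC n"]) (auto simp: bcomp_def bone_def binv_apply)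

lemma bcomp_assoc:
  assumes "\<phi> \<in> Bn n"
  shows "bcomp n (bcomp n \<phi> \<psi>) \<chi> = bcomp n \<phi> (bcomp n \<psi> \<chi>)"
  by (rule extensionalityI[of _ "FC n"]) (auto simp: bcomp_def Bn_closed[OF assms])

lemma group_BG: "group (BG n)"
  by (rule groupI) (auto simp: bcomp_in_Bn bone_in_Bn bcomp_assoc bcomp_bone_left
      intro: bcomp_binv_left binv_in_Bn)

lemma inv_BG: "\<phi> \<in> Bn n \<Longrightarrow> inv\<^bsub>BG n\<^esub> \<phi> = binv n \<phi>"
  by (rule group.inv_equality[OF group_BG]) (simp_all add: bcomp_binv_left binv_in_Bn)

lemma Bn_eqI:
  assumes "\<phi> \<in> Bn n" "\<psi> \<in> Bn n" "\<And>k. k \<in> {1..n} \<Longrightarrow> gimg \<phi> k = gimg \<psi> k"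
  shows "\<phi> = \<psi>"
  using hom_FG_eqI[OF BnD(1)[OF assms(1)] BnD(1)[OF assms(2)] BnD(3)[OF assms(1)] BnD(3)[OF assms(2)]]
    assms(3) by blast

lemma gimg_bcomp:
  assumes "\<phi> \<in> Bn n" "\<psi> \<in> Bn n" "k \<in> {1..n}"
  shows "gimg (bcomp n \<phi> \<psi>) k = ev (gimg \<psi>) (\<phi> (gen k))"
  using hom_eq_ev[OF BnD(1)[OF assms(2)] Bn_closed[OF assms(1) gen_in_FC[OF assms(3)]]] gen_in_FC[OF assms(3)]
  by (simp add: bcomp_def)

lemma gimg_bone: "k \<in> {1..n} \<Longrightarrow> gimg (bone n) k = tg k"
  by (simp add: bone_def gen_in_FC)

text \<open>The permutation condition puts the image of \<open>t_k\<close> into the conjugacy class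
  of some generator, where \<open>conj_normal_form\<close> applies.\<close>

lemma gimg_conj:
  assumes "\<phi> \<in> Bn n" "k \<in> {1..n}"
  obtains c where "tight c" "gimg \<phi> k = cval c"
proof -
  have "gen k \<in> conjclass n (gen k)"
    unfolding conjclass_def by (auto intro!: exI[of _ "[]"] simp: gen_def)
  then have "\<phi> (gen k) \<in> \<phi> ` conjclass n (gen k)" by blast
  moreover have "\<phi> ` conjclass n (gen k) \<in> genclasses n"
    using BnD(5)[OF assms(1)] assms(2) by blast
  ultimately obtain a where "\<phi> (gen k) \<in> conjclass n (gen a)" by blast
  then obtain g where g: "\<phi> (gen k) = red (g @ gen a @ winv g)" "g \<in> FC n"
    by (auto simp: conjclass_def)
  then have *: "gimg \<phi> k = cval (a, g)" by (simp add: cval_def cl_append cl_winv grp_simps)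
  have "reduced g" using g(2) by (simp add: FC_iff)
  then obtain u v where "tight (a, u)" "cval (a, g) = cval (a, u)"
    by (rule conj_normal_form)
  with * that show thesis by simp
qed

text \<open>\<open>z1 n\<close> is the inverse of \<open>t_1 ... t_n\<close>, so fixing one means
  fixing the other.\<close>

lemma gimg_prod:
  assumes "\<phi> \<in> Bn n"
  shows "sum_list (map (gimg \<phi>) [1..<Suc n]) = cl (tword 1 n)"
proof -
  have "rep (ev (gimg \<phi>) (z1 n)) = z1 n"
    using hom_eq_ev[OF BnD(1)[OF assms] z1_in_FC] BnD(4)[OF assms] by simp
  then have "ev (gimg \<phi>) (z1 n) = cl (z1 n)" by (metis cl_rep)
  then show ?thesis by (simp add: z1_eq ev_winv cl_winv ev_tword)
qed

section \<open>The generators \<open>sigma\<close> and Hurwitz moves\<close>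

text \<open>The images of the generators under the inverse of \<open>\<sigma>_j\<close>, as
  \<open>sigma_sigma_inv\<close> and \<open>binv_sigma\<close> confirm.\<close>

definition sigma_inv_img :: "nat \<Rightarrow> nat \<Rightarrow> letter list" where
  "sigma_inv_img j k = (if k = j then [(j, True), (Suc j, True), (j, False)]
                        else if k = Suc j then [(j, True)] else [(k, True)])"

lemma ext_hom_in_FC:
  assumes "\<And>k. k \<in> {1..n} \<Longrightarrow> f k \<in> FC n" "w \<in> FC n"
  shows "ext_hom f w \<in> FC n"
  unfolding ext_hom_def
proof (rule red_in_FC)
  define h where "h = (\<lambda>x. if snd x then f (fst x) else winv (f (fst x)))"
  have "fst ` set (h x) \<subseteq> {1..n}" if "x \<in> set w" for x
  proof -
    have "fst x \<in> {1..n}" using assms(2) that by (auto simp: FC_iff)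
    then have "fst ` set (f (fst x)) \<subseteq> {1..n}" using assms(1) by (simp add: FC_iff)
    then show ?thesis using fst_set_winv[of "f (fst x)"] by (simp add: h_def)
  qed
  then have "fst ` set (concat (map h w)) \<subseteq> {1..n}"
    by (simp add: image_subset_iff)
  then show "fst ` set (concat (map (\<lambda>x. if snd x then f (fst x) else winv (f (fst x))) w)) \<subseteq> {1..n}"
    by (simp only: h_def)
qed

lemma ext_hom_hom:
  assumes "\<And>k. k \<in> {1..n} \<Longrightarrow> f k \<in> FC n"
  shows "restrict (ext_hom f) (FC n) \<in> hom (FG n) (FG n)"
proof -
  have "ext_hom f (red (x @ y)) = red (ext_hom f x @ ext_hom f y)" for x y
    by (simp add: ext_hom_eq ev_append plus_fgrp_def)
  then show ?thesis
    unfolding hom_FG_iff using FC_mult ext_hom_in_FC[of n f, OF assms] by simp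
qed

lemma ext_hom_inverse:
  assumes "\<And>k. k \<in> {1..n} \<Longrightarrow> ev (\<lambda>k. cl (g k)) (f k) = tg k" "w \<in> FC n"
  shows "ext_hom g (ext_hom f w) = w"
proof -
  have "ev (\<lambda>k. cl (g k)) (rep (ev (\<lambda>k. cl (f k)) w)) = ev tg w"
    unfolding ev_rep_ev using assms by (intro ev_cong) (auto simp: FC_iff)
  then show ?thesis using assms(2) by (simp add: ext_hom_eq ev_tg FC_iff red_eq)
qed

lemma ext_hom_gen: "reduced (f k) \<Longrightarrow> ext_hom f (gen k) = f k"
  by (simp add: ext_hom_def gen_def red_eq)

text \<open>A Hurwitz move alters two neighbouring factors but not their product.\<close>

lemma sum_list_move:
  fixes A B :: "nat \<Rightarrow> fgrp"
  assumes "i \<le> j" "Suc j < m" "\<And>k. k \<noteq> j \<Longrightarrow> k \<noteq> Suc j \<Longrightarrow> A k = B k" "A j + A (Suc j) = B j + B (Suc j)"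
  shows "sum_list (map A [i..<m]) = sum_list (map B [i..<m])"
proof -
  have "[i..<m] = [i..<j] @ j # Suc j # [Suc (Suc j)..<m]"
    using assms(1,2) upt_add_eq_append[of i j "m - j"] by (simp add: upt_conv_Cons)
  moreover have "map A [i..<j] = map B [i..<j]" "map A [Suc (Suc j)..<m] = map B [Suc (Suc j)..<m]"
    using assms(3) by auto
  moreover have "A j + (A (Suc j) + x) = B j + (B (Suc j) + x)" for x
    using assms(4) by (simp flip: add.assoc)
  ultimately show ?thesis
    by (simp only: map_append list.map sum_list_append sum_list.Cons)
qed

lemma sigma_img_in_FC: "j \<in> {1..<n} \<Longrightarrow> k \<in> {1..n} \<Longrightarrow> sigma_img j k \<in> FC n"
  by (auto simp: FC_iff sigma_img_def reduced_Cons)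

lemma sigma_inv_img_in_FC: "j \<in> {1..<n} \<Longrightarrow> k \<in> {1..n} \<Longrightarrow> sigma_inv_img j k \<in> FC n"
  by (auto simp: FC_iff sigma_inv_img_def reduced_Cons)

lemma ev_sigma_img: "ev F (sigma_img j k) =
  (if k = j then F (Suc j) else if k = Suc j then - F (Suc j) + F j + F (Suc j) else F k)"
  by (simp add: sigma_img_def ev_Cons grp_simps)

lemma ev_sigma_inv_img: "ev F (sigma_inv_img j k) =
  (if k = j then F j + F (Suc j) + - F j else if k = Suc j then F j else F k)"
  by (simp add: sigma_inv_img_def ev_Cons grp_simps)

lemma cl_sigma_img: "cl (sigma_img j k) =
  (if k = j then tg (Suc j) else if k = Suc j then - tg (Suc j) + tg j + tg (Suc j) else tg k)"
  using ev_sigma_img[of tg j k] by (simp only: ev_tg)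

lemma cl_sigma_inv_img: "cl (sigma_inv_img j k) =
  (if k = j then tg j + tg (Suc j) + - tg j else if k = Suc j then tg j else tg k)"
  using ev_sigma_inv_img[of tg j k] by (simp only: ev_tg)

lemma sigma_sigma_inv:
  assumes "w \<in> FC n"
  shows "ext_hom (sigma_img j) (ext_hom (sigma_inv_img j) w) = w"
    and "ext_hom (sigma_inv_img j) (ext_hom (sigma_img j) w) = w"
  by (rule ext_hom_inverse[OF _ assms];
      simp add: ev_sigma_img ev_sigma_inv_img cl_sigma_img cl_sigma_inv_img grp_simps)+

lemma sigma_gen: "j \<in> {1..<n} \<Longrightarrow> k \<in> {1..n} \<Longrightarrow> sigma n j (gen k) = sigma_img j k"
  using sigma_img_in_FC[of j n k] gen_in_FC[of k n] ext_hom_gen[of "sigma_img j" k]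
  by (simp add: sigma_def) (simp add: FC_iff)

lemma sigma_in_Bn:
  assumes j: "j \<in> {1..<n}"
  shows "sigma n j \<in> Bn n"
proof (rule BnI)
  show hom: "sigma n j \<in> hom (FG n) (FG n)"
    unfolding sigma_def using sigma_img_in_FC[OF j] by (rule ext_hom_hom)
  show bij: "bij_betw (sigma n j) (FC n) (FC n)"
    using ext_hom_in_FC[of n "sigma_img j", OF sigma_img_in_FC[OF j]]
      ext_hom_in_FC[of n "sigma_inv_img j", OF sigma_inv_img_in_FC[OF j]] sigma_sigma_inv
    by (intro bij_betwI[of _ _ _ "ext_hom (sigma_inv_img j)"]) (auto simp: sigma_def)
  have "ev (\<lambda>k. cl (sigma_img j k)) (tword 1 n) = ev tg (tword 1 n)"
    unfolding ev_tword using j by (intro sum_list_move[of 1 j]) (auto simp: cl_sigma_img grp_simps)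
  then have "ext_hom (sigma_img j) (z1 n) = rep (cl (z1 n))"
    by (simp add: ext_hom_eq z1_eq ev_winv ev_tg cl_winv)
  then show "sigma n j (z1 n) = z1 n"
    using z1_in_FC[of n] by (simp add: sigma_def FC_iff red_eq)
  \<comment> \<open>\<open>s\<close> is the transposition that \<open>\<sigma>_j\<close> induces on
    the conjugacy classes of the generators.\<close>
  define s where "s k = (if k = j then Suc j else if k = Suc j then j else k)" for k
  have cls: "sigma n j ` conjclass n (gen k) = conjclass n (gen (s k))" if k: "k \<in> {1..n}" for k
  proof -
    have "sigma n j ` conjclass n (gen k) = conjclass n (sigma_img j k)"
      using image_conjclass[OF hom _ gen_in_FC[OF k]] bij sigma_gen[OF j k] by (simp add: bij_betw_def)
    also have "\<dots> = conjclass n (gen (s k))"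
    proof (cases "k = Suc j")
      case True
      have "sigma_img j k = red ([(Suc j, False)] @ gen j @ winv [(Suc j, False)])"
        by (simp add: True sigma_img_def gen_def)
      moreover have "[(Suc j, False)] \<in> FC n" using j by (simp add: FC_iff)
      ultimately have "conjclass n (sigma_img j k) = conjclass n (gen j)"
        using conjclass_conj by metis
      then show ?thesis using True by (simp add: s_def)
    qed (simp add: s_def sigma_img_def gen_def)
    finally show ?thesis .
  qed
  have "s ` {1..n} = {1..n}"
  proof
    show "{1..n} \<subseteq> s ` {1..n}"
    proof
      fix k assume "k \<in> {1..n}"
      then have "s k \<in> {1..n}" "s (s k) = k" using j by (auto simp: s_def)
      then show "k \<in> s ` {1..n}" by force
    qed
  qed (use j in \<open>auto simp: s_def\<close>)
  have "(\<lambda>C. sigma n j ` C) ` genclasses n = (\<lambda>k. sigma n j ` conjclass n (gen k)) ` {1..n}"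
    by (simp add: image_image)
  also have "\<dots> = (\<lambda>k. conjclass n (gen (s k))) ` {1..n}"
    by (rule image_cong[OF refl cls])
  also have "\<dots> = (\<lambda>k. conjclass n (gen k)) ` s ` {1..n}"
    by (simp add: image_image)
  also have "\<dots> = genclasses n"
    unfolding \<open>s ` {1..n} = {1..n}\<close> by (simp add: image_image)
  finally show "(\<lambda>C. sigma n j ` C) ` genclasses n = genclasses n" .
qed (simp add: sigma_def)

lemma binv_sigma:
  assumes j: "j \<in> {1..<n}"
  shows "binv n (sigma n j) = restrict (ext_hom (sigma_inv_img j)) (FC n)"
proof (rule extensionalityI[of _ "FC n"])
  fix w assume w: "w \<in> FC n"
  let ?v = "ext_hom (sigma_inv_img j) w"
  have v: "?v \<in> FC n" by (rule ext_hom_in_FC[OF sigma_inv_img_in_FC[OF j] w])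
  then have "sigma n j ?v = w" using sigma_sigma_inv(1)[OF w] by (simp add: sigma_def)
  then show "binv n (sigma n j) w = restrict (ext_hom (sigma_inv_img j)) (FC n) w"
    using binv_apply(3)[OF sigma_in_Bn[OF j] v] w by simp
qed (auto simp: binv_def)

text \<open>Composition runs from left to right, so \<open>\<phi>\<close> is evaluated on the words
  that \<open>\<sigma>_j\<close> assigns to the generators. The result is a Hurwitz move on entries
  \<open>j\<close> and \<open>j + 1\<close>.\<close>

lemma gimg_sigma:
  assumes "\<phi> \<in> Bn n" "j \<in> {1..<n}" "k \<in> {1..n}"
  shows "gimg (bcomp n (sigma n j) \<phi>) k =
    (if k = j then gimg \<phi> (Suc j)
     else if k = Suc j then - gimg \<phi> (Suc j) + gimg \<phi> j + gimg \<phi> (Suc j) else gimg \<phi> k)"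
  using gimg_bcomp[OF sigma_in_Bn[OF assms(2)] assms(1,3)] sigma_gen[OF assms(2,3)]
  by (simp add: ev_sigma_img)

lemma gimg_binv_sigma:
  assumes "\<phi> \<in> Bn n" "j \<in> {1..<n}" "k \<in> {1..n}"
  shows "gimg (bcomp n (binv n (sigma n j)) \<phi>) k =
    (if k = j then gimg \<phi> j + gimg \<phi> (Suc j) + - gimg \<phi> j
     else if k = Suc j then gimg \<phi> j else gimg \<phi> k)"
proof -
  have "binv n (sigma n j) (gen k) = sigma_inv_img j k"
    using sigma_inv_img_in_FC[OF assms(2,3)] gen_in_FC[OF assms(3)] ext_hom_gen[of "sigma_inv_img j" k]
    by (simp add: binv_sigma[OF assms(2)]) (simp add: FC_iff)
  then show ?thesis
    using gimg_bcomp[OF binv_in_Bn[OF sigma_in_Bn[OF assms(2)]] assms(1,3)]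
    by (simp add: ev_sigma_inv_img)
qed

section \<open>Braid words\<close>

lemma bprod_Nil [simp]: "bprod n [] = bone n"
  by (simp add: bprod_def)

lemma bprod_snoc: "bprod n (fs @ [f]) = bcomp n (bprod n fs) f"
  by (simp add: bprod_def)

lemma bprod_in_Bn: "set fs \<subseteq> Bn n \<Longrightarrow> bprod n fs \<in> Bn n"
  by (induction fs rule: rev_induct) (auto simp: bprod_snoc bone_in_Bn bcomp_in_Bn)

lemma bcomp_bone_right: "\<phi> \<in> Bn n \<Longrightarrow> bcomp n \<phi> (bone n) = \<phi>"
  using monoid.r_one[OF group.is_monoid[OF group_BG], of \<phi> n] by simp

lemma bcomp_binv_right: "\<phi> \<in> Bn n \<Longrightarrow> bcomp n \<phi> (binv n \<phi>) = bone n"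
  using group.r_inv[OF group_BG, of \<phi> n] by (simp add: inv_BG)

lemma binv_bcomp:
  "\<phi> \<in> Bn n \<Longrightarrow> \<psi> \<in> Bn n \<Longrightarrow> binv n (bcomp n \<phi> \<psi>) = bcomp n (binv n \<psi>) (binv n \<phi>)"
  using group.inv_mult_group[OF group_BG, of \<phi> n \<psi>] by (simp add: inv_BG bcomp_in_Bn)

lemma binv_binv: "\<phi> \<in> Bn n \<Longrightarrow> binv n (binv n \<phi>) = \<phi>"
  using group.inv_inv[OF group_BG, of \<phi> n] by (simp add: inv_BG binv_in_Bn)

lemma binv_bone: "binv n (bone n) = bone n"
  using bcomp_binv_left[OF bone_in_Bn] bcomp_bone_right[OF binv_in_Bn[OF bone_in_Bn]] by simp

lemma bprod_append:
  assumes "set fs \<subseteq> Bn n" "set gs \<subseteq> Bn n"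
  shows "bprod n (fs @ gs) = bcomp n (bprod n fs) (bprod n gs)"
  using assms(2)
proof (induction gs rule: rev_induct)
  case Nil
  then show ?case by (simp add: bcomp_bone_right bprod_in_Bn assms(1))
next
  case (snoc g gs)
  then show ?case
    by (simp add: bprod_snoc bcomp_assoc[OF bprod_in_Bn[OF assms(1)]] flip: append_assoc)
qed

definition sletters :: "nat \<Rightarrow> nat \<Rightarrow> (letter list \<Rightarrow> letter list) set" where
  "sletters n i = sigma n ` {i..n-1} \<union> (\<lambda>j. binv n (sigma n j)) ` {i..n-1}"

definition pletters :: "nat \<Rightarrow> nat \<Rightarrow> (letter list \<Rightarrow> letter list) set" where
  "pletters n i = sigma n ` {i..n-1} \<union> (\<lambda>j. binv n (sigma n j)) ` {Suc i..n-1}"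

text \<open>For \<open>i \<ge> 1\<close> this is the subgroup generated by
  \<open>\<sigma>_i, ..., \<sigma>_{n-1}\<close>; it is trivial once
  \<open>i \<ge> n\<close>.\<close>

definition Gfrom :: "nat \<Rightarrow> nat \<Rightarrow> (letter list \<Rightarrow> letter list) set" where
  "Gfrom n i = {bprod n fs | fs. set fs \<subseteq> sletters n i}"

text \<open>The \<sigma>-positive elements with a fixed index \<open>i\<close>, so that one index
  can be treated at a time; \<open>Ppos_eq\<close> takes the union.\<close>

definition Pfrom :: "nat \<Rightarrow> nat \<Rightarrow> (letter list \<Rightarrow> letter list) set" where
  "Pfrom n i = {bprod n fs | fs. set fs \<subseteq> pletters n i \<and> sigma n i \<in> set fs}"

lemma sletters_Bn: "1 \<le> i \<Longrightarrow> sletters n i \<subseteq> Bn n"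
  by (auto simp: sletters_def intro!: sigma_in_Bn binv_in_Bn)

lemma pletters_sletters: "pletters n i \<subseteq> sletters n i"
  by (auto simp: pletters_def sletters_def)

lemma sletters_mono: "i \<le> j \<Longrightarrow> sletters n j \<subseteq> sletters n i"
  unfolding sletters_def by (intro Un_mono image_mono) auto

lemma sletters_pletters: "sletters n (Suc i) \<subseteq> pletters n i"
  unfolding sletters_def pletters_def by (intro Un_mono image_mono) auto

lemma Gfrom_Bn: "1 \<le> i \<Longrightarrow> Gfrom n i \<subseteq> Bn n"
  unfolding Gfrom_def using sletters_Bn bprod_in_Bn by blast

lemma Gfrom_mono: "i \<le> j \<Longrightarrow> Gfrom n j \<subseteq> Gfrom n i"
  unfolding Gfrom_def using sletters_mono by blast

lemma Pfrom_Gfrom: "Pfrom n i \<subseteq> Gfrom n i"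
  unfolding Gfrom_def Pfrom_def using pletters_sletters by blast

lemma bone_Gfrom: "bone n \<in> Gfrom n i"
  unfolding Gfrom_def by (auto intro!: exI[of _ "[]"])

lemma Gfrom_bcomp:
  assumes "1 \<le> i" "\<phi> \<in> Gfrom n i" "\<psi> \<in> Gfrom n i"
  shows "bcomp n \<phi> \<psi> \<in> Gfrom n i"
proof -
  obtain fs gs where "\<phi> = bprod n fs" "\<psi> = bprod n gs" "set fs \<subseteq> sletters n i" "set gs \<subseteq> sletters n i"
    using assms by (auto simp: Gfrom_def)
  moreover from this have "bcomp n \<phi> \<psi> = bprod n (fs @ gs)"
    using bprod_append[of fs n gs] sletters_Bn[OF assms(1), of n] by auto
  ultimately show ?thesis unfolding Gfrom_def by (auto intro!: exI[of _ "fs @ gs"])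
qed

lemma sletters_Gfrom:
  assumes "1 \<le> i" "f \<in> sletters n i"
  shows "f \<in> Gfrom n i"
proof -
  have "f = bprod n [f]"
    using sletters_Bn[OF assms(1), of n] assms(2) by (auto simp: bprod_def bcomp_bone_left)
  then show ?thesis unfolding Gfrom_def using assms(2) by (auto intro!: exI[of _ "[f]"])
qed

lemma sigma_Gfrom: "1 \<le> i \<Longrightarrow> i \<le> j \<Longrightarrow> j < n \<Longrightarrow> sigma n j \<in> Gfrom n i"
  by (rule sletters_Gfrom) (auto simp: sletters_def)

lemma binv_sigma_Gfrom: "1 \<le> i \<Longrightarrow> i \<le> j \<Longrightarrow> j < n \<Longrightarrow> binv n (sigma n j) \<in> Gfrom n i"
  by (rule sletters_Gfrom) (auto simp: sletters_def)

lemma binv_sletters: "1 \<le> i \<Longrightarrow> f \<in> sletters n i \<Longrightarrow> binv n f \<in> sletters n i"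
  by (auto simp: sletters_def binv_binv sigma_in_Bn)

lemma binv_Gfrom:
  assumes "1 \<le> i" "\<phi> \<in> Gfrom n i"
  shows "binv n \<phi> \<in> Gfrom n i"
proof -
  obtain fs where "\<phi> = bprod n fs" "set fs \<subseteq> sletters n i" using assms(2) by (auto simp: Gfrom_def)
  moreover have "binv n (bprod n fs) \<in> Gfrom n i" if "set fs \<subseteq> sletters n i" for fs
    using that
  proof (induction fs rule: rev_induct)
    case Nil
    then show ?case by (simp add: binv_bone bone_Gfrom)
  next
    case (snoc f fs)
    then have "f \<in> Bn n" "bprod n fs \<in> Bn n"
      using sletters_Bn[OF assms(1), of n] by (auto intro!: bprod_in_Bn)
    moreover have "binv n f \<in> Gfrom n i"
      using snoc.prems by (intro sletters_Gfrom binv_sletters assms(1)) auto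
    ultimately show ?case
      using snoc Gfrom_bcomp[OF assms(1)] by (simp add: bprod_snoc binv_bcomp)
  qed
  ultimately show ?thesis by simp
qed

text \<open>The second factor is written without \<open>\<sigma>_i^-1\<close>, and the first one
  supplies an occurrence of \<open>\<sigma>_i\<close>.\<close>

lemma Pfrom_absorb:
  assumes "1 \<le> i" "\<phi> \<in> Pfrom n i" "\<psi> \<in> Gfrom n (Suc i) \<union> Pfrom n i"
  shows "bcomp n \<phi> \<psi> \<in> Pfrom n i" "bcomp n \<psi> \<phi> \<in> Pfrom n i"
proof -
  obtain fs where fs: "\<phi> = bprod n fs" "set fs \<subseteq> pletters n i" "sigma n i \<in> set fs"
    using assms(2) by (auto simp: Pfrom_def)
  obtain gs where gs: "\<psi> = bprod n gs" "set gs \<subseteq> pletters n i"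
    using assms(3) sletters_pletters by (auto simp: Pfrom_def Gfrom_def) blast+
  have B: "set fs \<subseteq> Bn n" "set gs \<subseteq> Bn n"
    using fs gs pletters_sletters sletters_Bn[OF assms(1)] by blast+
  have "bcomp n \<phi> \<psi> = bprod n (fs @ gs)" "bcomp n \<psi> \<phi> = bprod n (gs @ fs)"
    using bprod_append B fs(1) gs(1) by simp_all
  moreover have "bprod n (fs @ gs) \<in> Pfrom n i" "bprod n (gs @ fs) \<in> Pfrom n i"
    unfolding Pfrom_def mem_Collect_eq using fs gs
    by (intro exI[of _ "fs @ gs"] exI[of _ "gs @ fs"]; auto)+
  ultimately show "bcomp n \<phi> \<psi> \<in> Pfrom n i" "bcomp n \<psi> \<phi> \<in> Pfrom n i" by simp_all
qed

lemma sigma_Pfrom: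
  assumes "1 \<le> i" "i < n"
  shows "sigma n i \<in> Pfrom n i"
proof -
  have "sigma n i = bprod n [sigma n i]"
    using sigma_in_Bn assms by (auto simp: bprod_def bcomp_bone_left)
  then show ?thesis unfolding Pfrom_def pletters_def using assms by (auto intro!: exI[of _ "[sigma n i]"])
qed

lemma Ppos_eq: "Ppos n = (\<Union>i\<in>{1..<n}. Pfrom n i)"
proof -
  have "Pfrom n i \<subseteq> Bn n" if "1 \<le> i" for i using Pfrom_Gfrom Gfrom_Bn[OF that] by blast
  moreover have "sigma_positive n \<phi> \<longleftrightarrow> (\<exists>i\<in>{1..<n}. \<phi> \<in> Pfrom n i)" for \<phi>
    unfolding sigma_positive_def Pfrom_def pletters_def by (cases n) (auto simp: atLeastLessThanSuc_atLeastAtMost)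
  ultimately show ?thesis unfolding Ppos_def by fastforce
qed

text \<open>Every \<open>\<sigma>_j\<close> with \<open>j \<ge> i > k\<close> fixes
  \<open>t_k\<close>, so multiplication on the left by such letters leaves entry \<open>k\<close>
  unchanged.\<close>

lemma gimg_Gfrom:
  assumes "\<psi> \<in> Gfrom n i" "\<phi> \<in> Bn n" "1 \<le> k" "k < i" "k \<le> n"
  shows "gimg (bcomp n \<psi> \<phi>) k = gimg \<phi> k"
proof -
  have i: "1 \<le> i" using assms by simp
  have fixes_gen: "f (gen k) = gen k" if "f \<in> sletters n i" for f
  proof -
    from that obtain j where j: "j \<in> {i..n-1}" "f = sigma n j \<or> f = binv n (sigma n j)"
      by (auto simp: sletters_def)
    then have "sigma n j (gen k) = gen k"
      using assms sigma_gen[of j n k] by (auto simp: sigma_img_def gen_def)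
    then show ?thesis
      using j binv_apply(3)[OF sigma_in_Bn gen_in_FC, of j n k] assms by auto
  qed
  obtain fs where fs: "\<psi> = bprod n fs" "set fs \<subseteq> sletters n i" using assms(1) by (auto simp: Gfrom_def)
  have g: "gen k \<in> FC n" using assms by (intro gen_in_FC) auto
  have "bprod n fs (gen k) = gen k"
    using fs(2) by (induction fs rule: rev_induct) (auto simp: bone_def bprod_snoc bcomp_def g fixes_gen)
  then show ?thesis using fs(1) g by (simp add: bcomp_def)
qed

section \<open>Normalising by Hurwitz moves\<close>

lemma sum_decreases_at_pair:
  fixes f g :: "nat \<Rightarrow> nat"
  assumes "m \<le> j" "Suc j \<le> n" "\<And>k. k \<in> {m..n} \<Longrightarrow> k \<noteq> j \<Longrightarrow> k \<noteq> Suc j \<Longrightarrow> g k = f k"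
    "g j + g (Suc j) < f j + f (Suc j)"
  shows "sum g {m..n} < sum f {m..n}"
proof -
  have s: "sum h {m..n} = h j + h (Suc j) + sum h ({m..n} - {j, Suc j})" for h :: "nat \<Rightarrow> nat"
    using sum.subset_diff[of "{j, Suc j}" "{m..n}" h] assms(1,2) by simp
  have "sum g ({m..n} - {j, Suc j}) = sum f ({m..n} - {j, Suc j})"
    using assms(3) by (intro sum.cong) auto
  with assms(4) show ?thesis unfolding s by simp
qed

text \<open>Descent on the total length of the entries from position \<open>m\<close> on: as long as
  the normal forms are not settled, some loose pair allows a shortening move.\<close>

lemma settle:
  assumes "\<phi> \<in> Bn n" "1 \<le> m"
  obtains \<psi> cs where "\<psi> \<in> Gfrom n m" "settled cs"
    "map cval cs = map (gimg (bcomp n \<psi> \<phi>)) [m..<Suc n]"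
proof -
  have "\<exists>\<psi>\<in>Gfrom n m. \<exists>cs. settled cs \<and> map cval cs = map (gimg (bcomp n \<psi> \<phi>)) [m..<Suc n]"
    using assms(1)
  proof (induction "\<Sum>k\<in>{m..n}. length (rep (gimg \<phi> k))" arbitrary: \<phi> rule: less_induct)
    case less
    note \<phi> = less.prems
    have "\<forall>k\<in>{1..n}. \<exists>c. tight c \<and> gimg \<phi> k = cval c" using gimg_conj[OF \<phi>] by metis
    then obtain c where c: "\<And>k. k \<in> {1..n} \<Longrightarrow> tight (c k) \<and> gimg \<phi> k = cval (c k)" by metis
    define cs where "cs = map c [m..<Suc n]"
    have cs: "\<forall>x\<in>set cs. tight x" "map cval cs = map (gimg \<phi>) [m..<Suc n]"
      using c assms(2) by (auto simp: cs_def)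
    \<comment> \<open>It suffices to shorten the pair at \<open>j\<close> and \<open>j + 1\<close>,
      since the generator \<open>f\<close> leaves all other entries unchanged; the induction
      hypothesis then applies to \<open>bcomp n f \<phi>\<close>.\<close>
    have step: ?case if j: "m \<le> j" "Suc j \<le> n" and f: "f = sigma n j \<or> f = binv n (sigma n j)"
      and short: "length (rep (gimg (bcomp n f \<phi>) j)) + length (rep (gimg (bcomp n f \<phi>) (Suc j)))
        < length (rep (gimg \<phi> j)) + length (rep (gimg \<phi> (Suc j)))" for f j
    proof -
      have jn: "j \<in> {1..<n}" using j assms(2) by auto
      have fG: "f \<in> Gfrom n m"
        using f j assms(2) sigma_Gfrom[of m j n] binv_sigma_Gfrom[of m j n] by auto
      then have fB: "f \<in> Bn n" using Gfrom_Bn[OF assms(2)] by blast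
      have "gimg (bcomp n f \<phi>) k = gimg \<phi> k" if "k \<in> {m..n}" "k \<noteq> j" "k \<noteq> Suc j" for k
        using f gimg_sigma[OF \<phi> jn, of k] gimg_binv_sigma[OF \<phi> jn, of k] that assms(2) by auto
      then have "(\<Sum>k\<in>{m..n}. length (rep (gimg (bcomp n f \<phi>) k))) < (\<Sum>k\<in>{m..n}. length (rep (gimg \<phi> k)))"
        using j short by (intro sum_decreases_at_pair[of m j]) simp_all
      from less.hyps[OF this bcomp_in_Bn[OF fB \<phi>]] obtain \<psi> ds where \<psi>: "\<psi> \<in> Gfrom n m" "settled ds"
        "map cval ds = map (gimg (bcomp n \<psi> (bcomp n f \<phi>))) [m..<Suc n]" by blast
      have "\<psi> \<in> Bn n" using \<psi>(1) Gfrom_Bn[OF assms(2)] by blast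
      then have "bcomp n \<psi> (bcomp n f \<phi>) = bcomp n (bcomp n \<psi> f) \<phi>" by (simp add: bcomp_assoc)
      with \<psi> Gfrom_bcomp[OF assms(2) \<psi>(1) fG] show ?thesis by (intro bexI[of _ "bcomp n \<psi> f"]) auto
    qed
    show ?case
    proof (cases "settled cs")
      case True
      then show ?thesis
        using cs(2) bone_Gfrom by (intro bexI[of _ "bone n"] exI[of _ cs]) (simp_all add: bcomp_bone_left \<phi>)
    next
      case False
      then obtain l where l: "Suc l < length cs" "loose_left (cs ! l) (cs ! Suc l) \<or> loose_right (cs ! l) (cs ! Suc l)"
        using cs(1) by (auto simp: successively_conv_nth)
      define j where "j = m + l"
      have j: "m \<le> j" "Suc j \<le> n" using l(1) by (auto simp: j_def cs_def)
      have cj: "cs ! l = c j" "cs ! Suc l = c (Suc j)" using l(1) by (auto simp: cs_def j_def)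
      have jn: "j \<in> {1..<n}" "j \<in> {1..n}" "Suc j \<in> {1..n}" using j assms(2) by auto
      from l(2) show ?thesis
      proof
        assume "loose_left (cs ! l) (cs ! Suc l)"
        then have "length (rep (gimg \<phi> j + gimg \<phi> (Suc j) + - gimg \<phi> j)) < length (rep (gimg \<phi> (Suc j)))"
          using loose_left_shortens c jn by (simp add: cj)
        \<comment> \<open>\<open>\<sigma>_j^-1\<close> puts the shortened conjugate at position
          \<open>j\<close> and the old entry \<open>j\<close> at position
          \<open>j + 1\<close>.\<close>
        then show ?thesis
          using gimg_binv_sigma[OF \<phi> jn(1)] jn by (intro step[OF j, of "binv n (sigma n j)"]) auto
      next
        assume "loose_right (cs ! l) (cs ! Suc l)"
        then have "length (rep (- gimg \<phi> (Suc j) + gimg \<phi> j + gimg \<phi> (Suc j))) < length (rep (gimg \<phi> j))"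
          using loose_right_shortens c jn by (simp add: cj)
        then show ?thesis
          using gimg_sigma[OF \<phi> jn(1)] jn by (intro step[OF j, of "sigma n j"]) auto
      qed
    qed
  qed
  with that show thesis by blast
qed

text \<open>\<open>\<sigma>_{k-1}^-1\<close> moves entry \<open>k\<close> one place to the left and
  conjugates it by entry \<open>k - 1\<close>. Repeated down to position \<open>m\<close>, this
  conjugates it by the product of all entries passed.\<close>

lemma move_to_front:
  assumes "\<phi> \<in> Bn n" "1 \<le> m" "m \<le> k" "k \<le> n"
  obtains \<psi> where "\<psi> \<in> Gfrom n m"
    "gimg (bcomp n \<psi> \<phi>) m =
       sum_list (map (gimg \<phi>) [m..<k]) + gimg \<phi> k + - sum_list (map (gimg \<phi>) [m..<k])"
proof -
  have "\<exists>\<psi>\<in>Gfrom n m. gimg (bcomp n \<psi> \<phi>) m =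
       sum_list (map (gimg \<phi>) [m..<k]) + gimg \<phi> k + - sum_list (map (gimg \<phi>) [m..<k])"
    using assms(3,4,1)
  proof (induction k arbitrary: \<phi> rule: dec_induct)
    case base
    then show ?case
      using bone_Gfrom by (intro bexI[of _ "bone n"]) (simp_all add: bcomp_bone_left)
  next
    case (step k)
    let ?f = "binv n (sigma n k)"
    have k: "k \<in> {1..<n}" "k \<in> {1..n}" using step assms(2) by auto
    have fG: "?f \<in> Gfrom n m" using step assms(2) by (intro binv_sigma_Gfrom) auto
    then have fB: "?f \<in> Bn n" using Gfrom_Bn[OF assms(2)] by blast
    note g = gimg_binv_sigma[OF step.prems(2) k(1)]
    have "sum_list (map (gimg (bcomp n ?f \<phi>)) [m..<k]) = sum_list (map (gimg \<phi>) [m..<k])"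
      using g step assms(2) by (intro arg_cong[where f = sum_list]) auto
    moreover have "gimg (bcomp n ?f \<phi>) k = gimg \<phi> k + gimg \<phi> (Suc k) + - gimg \<phi> k"
      using g[OF k(2)] by simp
    moreover obtain \<psi> where \<psi>: "\<psi> \<in> Gfrom n m" "gimg (bcomp n \<psi> (bcomp n ?f \<phi>)) m =
       sum_list (map (gimg (bcomp n ?f \<phi>)) [m..<k]) + gimg (bcomp n ?f \<phi>) k
       + - sum_list (map (gimg (bcomp n ?f \<phi>)) [m..<k])"
      using step.IH[OF _ bcomp_in_Bn[OF fB step.prems(2)]] step.prems(1) by auto
    moreover have "\<psi> \<in> Bn n" using \<psi>(1) Gfrom_Bn[OF assms(2)] by blast
    then have "bcomp n \<psi> (bcomp n ?f \<phi>) = bcomp n (bcomp n \<psi> ?f) \<phi>" by (simp add: bcomp_assoc)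
    moreover have "sum_list (map (gimg \<phi>) [m..<Suc k]) = sum_list (map (gimg \<phi>) [m..<k]) + gimg \<phi> k"
      using step.hyps by (simp add: upt_Suc)
    ultimately show ?case
      using Gfrom_bcomp[OF assms(2) \<psi>(1) fG]
      by (intro bexI[of _ "bcomp n \<psi> ?f"]) (simp_all add: grp_simps)
  qed
  with that show thesis by blast
qed

section \<open>First letters under \<open>sigma\<close>\<close>

text \<open>Both \<open>sigma\<close> and its inverse have this shape: the inverse of the \<open>j\<close>-th generator for
  \<open>p = (j, True)\<close>, \<open>q = (Suc j, True)\<close>, the generator itself for
  \<open>p = (Suc j, False)\<close>, \<open>q = (j, False)\<close>.\<close>

definition twist :: "letter \<Rightarrow> letter \<Rightarrow> letter \<Rightarrow> letter list" where
  "twist p q x = (if x = p then [p, q, linv p] else if x = linv p then [p, linv q, linv p]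
     else if x = q then [p] else if x = linv q then [linv p] else [x])"

lemma ext_hom_sigma_inv: "ext_hom (sigma_inv_img j) w = red (concat (map (twist (j, True) (Suc j, True)) w))"
  unfolding ext_hom_def
  by (intro arg_cong[where f = red] arg_cong[where f = concat] map_cong refl)
     (auto simp: twist_def sigma_inv_img_def winv_Cons)

lemma ext_hom_sigma: "ext_hom (sigma_img j) w = red (concat (map (twist (Suc j, False) (j, False)) w))"
  unfolding ext_hom_def
  by (intro arg_cong[where f = red] arg_cong[where f = concat] map_cong refl)
     (auto simp: twist_def sigma_img_def winv_Cons)

lemma red_Cons_reduced:
  "reduced r \<Longrightarrow> red (x # r) = (if r \<noteq> [] \<and> hd r = linv x then tl r else x # r)"
  using red_eq[of r] by (auto split: list.split)

lemma letter_eq_if_fst_eq: "fst x = fst y \<Longrightarrow> x = y \<or> x = linv y"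
  by (cases x; cases y) auto

text \<open>A block ending in \<open>p^-1\<close> can cancel the \<open>p\<close> in front of the
  image of the remaining word and expose the second letter. The claim therefore also controls second
  letters; with them, reducedness of \<open>w\<close> excludes further cancellation.\<close>

lemma twist_first_letter:
  assumes pq: "fst p \<noteq> fst q" and "reduced w" "w \<noteq> []"
  defines "r \<equiv> red (concat (map (twist p q) w))"
  shows "r \<noteq> [] \<and> (hd w = p \<longrightarrow> (\<exists>r'. r = p # q # r')) \<and> (hd w = linv p \<longrightarrow> (\<exists>r'. r = p # linv q # r'))
    \<and> (hd w = q \<longrightarrow> (\<exists>r'. r = p # r' \<and> (r' \<noteq> [] \<longrightarrow> fst (hd r') \<noteq> fst q)))
    \<and> (hd w = linv q \<longrightarrow> hd r \<noteq> p \<and> fst (hd r) \<in> {fst p, fst q})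
    \<and> (fst (hd w) \<notin> {fst p, fst q} \<longrightarrow> hd r = hd w)"
  using assms(2,3) unfolding r_def
proof (induction w)
  case (Cons x w)
  define s where "s = red (concat (map (twist p q) w))"
  have r: "red (concat (map (twist p q) (x # w))) = red (twist p q x @ s)"
    by (simp add: s_def)
  have sred: "reduced s" by (simp add: s_def)
  have neq: "p \<noteq> q" "p \<noteq> linv q" "q \<noteq> p" "linv p \<noteq> q" "q \<noteq> linv p" "linv q \<noteq> p"
    using pq by auto
  have w: "reduced w" "w \<noteq> [] \<Longrightarrow> hd w \<noteq> linv x" using Cons.prems by (auto simp: reduced_Cons)
  consider (Nil) "w = []" "s = []" | (p) s' where "w \<noteq> []" "hd w = p" "s = p # q # s'"
    | (p') s' where "w \<noteq> []" "hd w = linv p" "s = p # linv q # s'"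
    | (q) s' where "w \<noteq> []" "hd w = q" "s = p # s'" "s' \<noteq> [] \<Longrightarrow> fst (hd s') \<noteq> fst q"
    | (q') y s' where "w \<noteq> []" "hd w = linv q" "s = y # s'" "y \<noteq> p" "fst y \<in> {fst p, fst q}"
    | (other) s' where "w \<noteq> []" "s = hd w # s'" "fst (hd w) \<notin> {fst p, fst q}"
  proof (cases "w = []")
    case False
    have IH: "s \<noteq> [] \<and> (hd w = p \<longrightarrow> (\<exists>r'. s = p # q # r')) \<and> (hd w = linv p \<longrightarrow> (\<exists>r'. s = p # linv q # r'))
      \<and> (hd w = q \<longrightarrow> (\<exists>r'. s = p # r' \<and> (r' \<noteq> [] \<longrightarrow> fst (hd r') \<noteq> fst q)))
      \<and> (hd w = linv q \<longrightarrow> hd s \<noteq> p \<and> fst (hd s) \<in> {fst p, fst q})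
      \<and> (fst (hd w) \<notin> {fst p, fst q} \<longrightarrow> hd s = hd w)"
      using Cons.IH w(1) False by (simp add: s_def)
    then obtain y s' where s: "s = y # s'" by (cases s) auto
    show thesis
    proof (cases "hd w = linv q")
      case True
      then show thesis using IH \<open>w \<noteq> []\<close> s by (intro that(5)[of y s']) auto
    next
      case False
      then show thesis
        using that(2-4,6) IH \<open>w \<noteq> []\<close> s letter_eq_if_fst_eq[of "hd w" p] letter_eq_if_fst_eq[of "hd w" q] by auto
    qed
  qed (simp add: that(1) s_def)
  note c = this
  \<comment> \<open>The blocks of \<open>p\<close>, \<open>p^-1\<close> and \<open>q^-1\<close> all
    end in \<open>p^-1\<close>; \<open>d\<close> is what this letter and the image \<open>s\<close>
    of the remaining word reduce to.\<close>
  define d where "d = red (linv p # s)"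
  have d: "d = (if s \<noteq> [] \<and> hd s = p then tl s else linv p # s)"
    using red_Cons_reduced[OF sred, of "linv p"] by (simp only: d_def linv_linv)
  have dred: "reduced d" unfolding d_def by (rule reduced_red)
  \<comment> \<open>The conditions on \<open>hd w\<close> come from reducedness of
    \<open>x # w\<close>. For \<open>x = p\<close> it excludes \<open>p^-1\<close>, the only first
    letter of \<open>w\<close> that could bring \<open>q^-1\<close> to the front of
    \<open>d\<close>.\<close>
  have d1: "hd d \<noteq> linv q" if "w \<noteq> [] \<Longrightarrow> hd w \<noteq> linv p" "d \<noteq> []"
    using c by cases (use that neq in \<open>auto simp: d\<close>)
  have d2: "hd d \<noteq> q" if "w \<noteq> [] \<Longrightarrow> hd w \<noteq> p" "d \<noteq> []"
    using c by cases (use that neq in \<open>auto simp: d\<close>)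
  have d3: "d \<noteq> []" "hd d \<noteq> p" "fst (hd d) \<in> {fst p, fst q}" if "w \<noteq> [] \<Longrightarrow> hd w \<noteq> q"
    using c by (cases; use that neq in \<open>auto simp: d\<close>)+
  have s1: "hd s \<noteq> linv p" "fst (hd s) \<noteq> fst q" if "w \<noteq> [] \<Longrightarrow> hd w \<noteq> linv q" "s \<noteq> []"
    using c by (cases; use that pq in auto)+
  have s2: "hd s \<noteq> linv x" if "s \<noteq> []" "fst x \<notin> {fst p, fst q}"
    using c by cases (use that w(2) in auto)
  have "x = p \<or> x = linv p \<or> x = q \<or> x = linv q \<or> fst x \<notin> {fst p, fst q}"
    using letter_eq_if_fst_eq[of x p] letter_eq_if_fst_eq[of x q] by auto
  then consider (p) "x = p" | (p') "x = linv p" | (q) "x = q" | (q') "x = linv q"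
    | (other) "fst x \<notin> {fst p, fst q}" by blast
  then show ?case
  proof cases
    case p
    have "reduced (p # q # d)" using d1 w(2) p neq dred by (auto simp: reduced_Cons)
    then have "red (twist p q x @ s) = p # q # d"
      using red_append_red[of "[p, q]" "linv p # s"] by (simp add: p twist_def d_def[symmetric] red_eq del: red.simps red_append_red)
    then show ?thesis unfolding r using p neq pq by auto
  next
    case p'
    have "reduced (p # linv q # d)" using d2 w(2) p' neq dred by (auto simp: reduced_Cons)
    then have "red (twist p q x @ s) = p # linv q # d"
      using red_append_red[of "[p, linv q]" "linv p # s"] by (simp add: p' twist_def d_def[symmetric] red_eq del: red.simps red_append_red)
    then show ?thesis unfolding r using p' neq pq by auto
  next
    case q
    have "reduced (p # s)" using s1(1) w(2) q sred by (auto simp: reduced_Cons)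
    then have "red (twist p q x @ s) = p # s"
      using neq by (simp add: q twist_def red_eq del: red.simps)
    then show ?thesis unfolding r using q neq s1(2) w(2) pq by auto
  next
    case q'
    then have "red (twist p q x @ s) = d"
      using neq by (simp add: twist_def d_def del: red.simps)
    then show ?thesis unfolding r using q' neq d3 w(2) pq by auto
  next
    case other
    then have "reduced (x # s)" using s2 sred by (auto simp: reduced_Cons)
    moreover have "x \<noteq> p" "x \<noteq> linv p" "x \<noteq> q" "x \<noteq> linv q" using other by auto
    ultimately have "red (twist p q x @ s) = x # s"
      by (simp add: twist_def red_eq del: red.simps)
    then show ?thesis unfolding r using other by auto
  qed
qed simp

section \<open>Positive braids are nontrivial\<close>

definition starts :: "nat \<Rightarrow> letter list \<Rightarrow> bool" where
  "starts i w \<longleftrightarrow> w \<noteq> [] \<and> hd w = (i, True)"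

text \<open>For \<open>j = i\<close> the letter \<open>t_i\<close> is the \<open>p\<close> of the
  twist, whose image begins with \<open>p\<close>. For \<open>j > i\<close> it does not take part in
  the twist and stays in front.\<close>

lemma starts_sigma_inv:
  assumes "reduced w" "starts i w" "i \<le> j"
  shows "starts i (ext_hom (sigma_inv_img j) w)"
  using twist_first_letter[of "(j, True)" "(Suc j, True)" w] assms
  by (cases "i = j") (auto simp: starts_def ext_hom_sigma_inv)

lemma starts_sigma:
  assumes "reduced w" "starts i w" "i < j"
  shows "starts i (ext_hom (sigma_img j) w)"
  using twist_first_letter[of "(Suc j, False)" "(j, False)" w] assms
  by (auto simp: starts_def ext_hom_sigma)

text \<open>The inverse of an allowed letter is some \<open>\<sigma>_j^-1\<close> with
  \<open>j \<ge> i\<close> or some \<open>\<sigma>_j\<close> with \<open>j > i\<close>. These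
  preserve \<open>starts i\<close>, so the letters preserve its negation.\<close>

lemma pletters_not_starts:
  assumes "1 \<le> i" "f \<in> pletters n i" "w \<in> FC n" "\<not> starts i w"
  shows "\<not> starts i (f w)"
proof
  assume s: "starts i (f w)"
  have fB: "f \<in> Bn n" using assms(1,2) sletters_Bn pletters_sletters by blast
  have fw: "f w \<in> FC n" by (rule Bn_closed[OF fB assms(3)])
  from assms(2) consider j where "j \<in> {i..n-1}" "f = sigma n j" | j where "j \<in> {Suc i..n-1}" "f = binv n (sigma n j)"
    unfolding pletters_def by blast
  then have "starts i w"
  proof cases
    case 1
    have "w = ext_hom (sigma_inv_img j) (f w)"
      using sigma_sigma_inv(2)[OF assms(3)] assms(3) 1 by (simp add: sigma_def)
    with starts_sigma_inv[of "f w" i j] s fw 1 show ?thesis by (simp add: FC_iff)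
  next
    case 2
    have "w = ext_hom (sigma_img j) (f w)"
      using sigma_sigma_inv(1)[OF assms(3)] assms(1,3) 2 binv_sigma[of j n] by auto
    with starts_sigma[of "f w" i j] s fw 2 show ?thesis by (simp add: FC_iff)
  qed
  with assms(4) show False by simp
qed

text \<open>The letters before the first \<open>\<sigma>_i\<close> fix \<open>t_i\<close>, that
  \<open>\<sigma>_i\<close> turns it into \<open>t_{i+1}\<close>, and
  \<open>pletters_not_starts\<close> takes care of the remaining letters.\<close>

lemma Pfrom_not_starts:
  assumes "1 \<le> i" "i < n" "\<phi> \<in> Pfrom n i"
  shows "\<not> starts i (\<phi> (gen i))"
proof -
  obtain fs where fs: "\<phi> = bprod n fs" "set fs \<subseteq> pletters n i" "sigma n i \<in> set fs"
    using assms(3) by (auto simp: Pfrom_def)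
  then obtain fs1 fs2 where split: "fs = fs1 @ sigma n i # fs2" "sigma n i \<notin> set fs1"
    by (metis split_list_first)
  have g: "gen i \<in> FC n" using assms by (intro gen_in_FC) auto
  have "set fs1 \<subseteq> sletters n (Suc i)"
  proof
    fix f assume "f \<in> set fs1"
    with split fs(2) have "f \<in> pletters n i" "f \<noteq> sigma n i" by auto
    then consider j where "j \<in> {i..n-1}" "f = sigma n j" "j \<noteq> i"
      | j where "j \<in> {Suc i..n-1}" "f = binv n (sigma n j)"
      unfolding pletters_def by blast
    then show "f \<in> sletters n (Suc i)"
    proof cases
      case 1
      then have "j \<in> {Suc i..n-1}" by auto
      with 1 show ?thesis by (simp add: sletters_def)
    qed (simp add: sletters_def)
  qed
  then have G: "bprod n fs1 \<in> Gfrom n (Suc i)" unfolding Gfrom_def by blast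
  have s: "sigma n i \<in> Bn n" using assms by (intro sigma_in_Bn) auto
  have "bprod n fs1 \<in> Bn n" using Gfrom_Bn[of "Suc i" n] G by auto
  then have "bprod n (fs1 @ [sigma n i]) \<in> Bn n"
    unfolding bprod_snoc using s by (rule bcomp_in_Bn)
  then have "reduced (bprod n (fs1 @ [sigma n i]) (gen i))"
    using Bn_closed[OF _ g] by (simp only: FC_iff)
  then have "bprod n (fs1 @ [sigma n i]) (gen i) = rep (gimg (bprod n (fs1 @ [sigma n i])) i)"
    by (simp only: rep_cl red_eq)
  moreover have "gimg (bprod n (fs1 @ [sigma n i])) i = tg (Suc i)"
    using gimg_Gfrom[OF G s, of i] assms by (simp add: bprod_snoc sigma_gen sigma_img_def)
  ultimately have start: "bprod n (fs1 @ [sigma n i]) (gen i) = gen (Suc i)"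
    by (simp only: gen_def rep_tg)
  have "\<not> starts i (bprod n ((fs1 @ [sigma n i]) @ gs) (gen i))" if "set gs \<subseteq> pletters n i" for gs
    using that
  proof (induction gs rule: rev_induct)
    case Nil
    then show ?case using start by (simp add: starts_def gen_def)
  next
    case (snoc f gs)
    let ?h = "bprod n ((fs1 @ [sigma n i]) @ gs)"
    have "set ((fs1 @ [sigma n i]) @ gs) \<subseteq> pletters n i" using snoc.prems fs(2) split(1) by auto
    then have "?h \<in> Bn n"
      by (rule bprod_in_Bn[OF order_trans[OF _ order_trans[OF pletters_sletters sletters_Bn[OF assms(1)]]]])
    then have "?h (gen i) \<in> FC n" by (rule Bn_closed[OF _ g])
    moreover have "f \<in> pletters n i" "\<not> starts i (?h (gen i))" using snoc by simp_all
    ultimately have "\<not> starts i (f (?h (gen i)))"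
      using pletters_not_starts[OF assms(1)] by blast
    moreover have "bprod n ((fs1 @ [sigma n i]) @ gs @ [f]) (gen i) = f (?h (gen i))"
      using bprod_snoc[of n "(fs1 @ [sigma n i]) @ gs" f] g by (simp add: bcomp_def)
    ultimately show ?case by simp
  qed
  from this[of fs2] show ?thesis using fs split by simp
qed

lemma bone_not_Ppos: "bone n \<notin> Ppos n"
proof
  assume "bone n \<in> Ppos n"
  then obtain i where "1 \<le> i" "i < n" "bone n \<in> Pfrom n i" by (auto simp: Ppos_eq)
  from Pfrom_not_starts[OF this] \<open>1 \<le> i\<close> \<open>i < n\<close> gen_in_FC[of i n]
  show False by (simp add: bone_def starts_def gen_def)
qed

section \<open>Every nontrivial braid is positive or negative\<close>

abbreviation fixes_below :: "nat \<Rightarrow> (letter list \<Rightarrow> letter list) \<Rightarrow> bool" where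
  "fixes_below i \<phi> \<equiv> (\<forall>k\<in>{1..<i}. gimg \<phi> k = tg k)"

text \<open>The common prefix \<open>t_1 ... t_{i-1}\<close> is cancelled from both
  products.\<close>

lemma gimg_prod_from:
  assumes "\<phi> \<in> Bn n" "1 \<le> i" "i \<le> n" "fixes_below i \<phi>"
  shows "gimg \<phi> i + sum_list (map (gimg \<phi>) [Suc i..<Suc n]) = cl (tword i n)"
proof -
  have s: "[1..<Suc n] = [1..<i] @ [i..<Suc n]"
    using upt_add_eq_append[of 1 i "Suc n - i"] assms by simp
  have "map (gimg \<phi>) [1..<i] = map tg [1..<i]" using assms by auto
  then have "sum_list (map tg [1..<i]) + sum_list (map (gimg \<phi>) [i..<Suc n]) = sum_list (map (gimg \<phi>) [1..<Suc n])"
    by (simp only: s map_append sum_list_append)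
  also have "\<dots> = sum_list (map tg [1..<Suc n])"
    using gimg_prod[OF assms(1)] ev_tword[of tg 1 n] by (simp add: ev_tg)
  also have "\<dots> = sum_list (map tg [1..<i]) + sum_list (map tg [i..<Suc n])"
    by (simp only: s map_append sum_list_append)
  finally have "sum_list (map (gimg \<phi>) [i..<Suc n]) = sum_list (map tg [i..<Suc n])" by simp
  then show ?thesis
    using assms(3) ev_tword[of tg i n] by (simp add: upt_conv_Cons[of i] ev_tg)
qed

lemma gimg_last:
  assumes "\<phi> \<in> Bn n" "1 \<le> n" "fixes_below n \<phi>"
  shows "gimg \<phi> n = tg n"
  using gimg_prod_from[OF assms(1,2) _ assms(3)] by (simp add: upt_conv_Cons[of n "Suc n"])

lemma fixes_all_imp_bone:
  assumes "\<phi> \<in> Bn n" "\<forall>k\<in>{1..n}. gimg \<phi> k = tg k"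
  shows "\<phi> = bone n"
  using Bn_eqI[OF assms(1) bone_in_Bn] assms(2) gimg_bone by simp

lemma fixes_below_Gfrom:
  assumes "\<psi> \<in> Gfrom n (Suc i)" "\<phi> \<in> Bn n" "i \<le> n" "fixes_below i \<phi>"
  shows "fixes_below i (bcomp n \<psi> \<phi>)"
  using gimg_Gfrom[OF assms(1,2)] assms(3,4) by auto

lemma settled_prefix_sum:
  assumes "map cval cs = map A [m..<Suc n]" "cs = cs1 @ c # cs2"
  shows "map cval cs1 = map A [m..<m + length cs1]" "cval c = A (m + length cs1)"
    "m + length cs1 \<le> n"
proof -
  have len: "length cs = Suc n - m" using arg_cong[OF assms(1), of length] by simp
  then show le: "m + length cs1 \<le> n" using assms(2) by simp
  have "map cval cs1 = take (length cs1) (map cval cs)" by (simp add: assms(2))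
  also have "\<dots> = map A (take (length cs1) [m..<Suc n])" by (simp only: assms(1) take_map)
  finally show "map cval cs1 = map A [m..<m + length cs1]" using le by (simp add: take_upt)
  have "cval c = map cval cs ! length cs1" by (simp add: assms(2) nth_append)
  also have "\<dots> = A (m + length cs1)" unfolding assms(1) using le by (subst nth_map) auto
  finally show "cval c = A (m + length cs1)" .
qed

text \<open>Settling from position \<open>i + 1\<close> on leaves entry \<open>i\<close> alone, so
  the product condition yields the marked word of \<open>A_i^-1 t_i ... t_n\<close>. The last
  property combines this settling with \<open>move_to_front\<close>.\<close>

lemma settled_representative:
  assumes \<phi>: "\<phi> \<in> Bn n" and i: "1 \<le> i" "i < n" and fix_i: "fixes_below i \<phi>"
  obtains a p cs where "tight (a, p)" "gimg \<phi> i = cval (a, p)" "settled cs"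
    "sum_list (map cval cs) = - cval (a, p) + cl (tword i n)"
    "\<And>cs1 c cs2. cs = cs1 @ c # cs2 \<Longrightarrow> \<exists>\<psi>\<in>Gfrom n (Suc i).
       gimg (bcomp n \<psi> \<phi>) (Suc i) = sum_list (map cval cs1) + cval c + - sum_list (map cval cs1)"
proof -
  obtain \<psi>1 cs where \<psi>1: "\<psi>1 \<in> Gfrom n (Suc i)" "settled cs"
    "map cval cs = map (gimg (bcomp n \<psi>1 \<phi>)) [Suc i..<Suc n]"
    using settle[OF \<phi>, of "Suc i"] by auto
  define \<phi>1 where "\<phi>1 = bcomp n \<psi>1 \<phi>"
  have \<psi>1B: "\<psi>1 \<in> Bn n" using \<psi>1(1) Gfrom_Bn[of "Suc i" n] by auto
  have \<phi>1: "\<phi>1 \<in> Bn n" "fixes_below i \<phi>1" "gimg \<phi>1 i = gimg \<phi> i"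
    using \<psi>1B \<phi> fixes_below_Gfrom[OF \<psi>1(1) \<phi> _ fix_i] gimg_Gfrom[OF \<psi>1(1) \<phi>, of i] i
    by (simp_all add: \<phi>1_def bcomp_in_Bn)
  obtain a p where c: "tight (a, p)" "gimg \<phi> i = cval (a, p)"
    using gimg_conj[OF \<phi>, of i] i by auto
  have "cval (a, p) + sum_list (map cval cs) = cl (tword i n)"
    using gimg_prod_from[OF \<phi>1(1) i(1) _ \<phi>1(2)] i \<psi>1(3) \<phi>1(3) c(2) by (simp add: \<phi>1_def)
  then have sum: "sum_list (map cval cs) = - cval (a, p) + cl (tword i n)"
    by (metis minus_add_cancel)
  have "\<exists>\<psi>\<in>Gfrom n (Suc i).
       gimg (bcomp n \<psi> \<phi>) (Suc i) = sum_list (map cval cs1) + cval c + - sum_list (map cval cs1)"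
    if "cs = cs1 @ c # cs2" for cs1 c cs2
  proof -
    note pre = settled_prefix_sum[OF \<psi>1(3)[folded \<phi>1_def] that]
    have m: "1 \<le> Suc i" "Suc i \<le> Suc i + length cs1" by simp_all
    obtain \<psi>2 where \<psi>2: "\<psi>2 \<in> Gfrom n (Suc i)" "gimg (bcomp n \<psi>2 \<phi>1) (Suc i) =
       sum_list (map cval cs1) + cval c + - sum_list (map cval cs1)"
      unfolding pre(1,2) by (rule move_to_front[OF \<phi>1(1) m pre(3)])
    have "\<psi>2 \<in> Bn n" using \<psi>2(1) Gfrom_Bn[of "Suc i" n] by auto
    then have "bcomp n (bcomp n \<psi>2 \<psi>1) \<phi> = bcomp n \<psi>2 \<phi>1"
      by (simp add: bcomp_assoc \<phi>1_def)
    then show ?thesis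
      using \<psi>2 Gfrom_bcomp[OF _ \<psi>2(1) \<psi>1(1)] by (intro bexI[of _ "bcomp n \<psi>2 \<psi>1"]) auto
  qed
  with that c \<psi>1(2) sum show thesis by blast
qed

text \<open>\<open>mark_after_middle\<close> selects the conjugate to bring next to
  \<open>A_i\<close>; \<open>\<sigma>_i^-1\<close> then conjugates it by \<open>A_i\<close> and puts
  it at position \<open>i\<close>.\<close>

lemma positive_step:
  assumes \<phi>: "\<phi> \<in> Bn n" and i: "1 \<le> i" "i < n" and fix_i: "fixes_below i \<phi>"
    and hd: "\<not> starts i (rep (gimg \<phi> i))"
  obtains \<psi> where "\<psi> \<in> Gfrom n (Suc i)"
    "let B = gimg (bcomp n (binv n (sigma n i)) (bcomp n \<psi> \<phi>)) i
     in B = tg i \<or> length (rep B) < length (rep (gimg \<phi> i)) \<and> \<not> starts i (rep B)"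
proof -
  obtain a p cs where c: "tight (a, p)" "gimg \<phi> i = cval (a, p)" "settled cs"
    "sum_list (map cval cs) = - cval (a, p) + cl (tword i n)"
    and move: "\<And>cs1 c cs2. cs = cs1 @ c # cs2 \<Longrightarrow> \<exists>\<psi>\<in>Gfrom n (Suc i).
       gimg (bcomp n \<psi> \<phi>) (Suc i) = sum_list (map cval cs1) + cval c + - sum_list (map cval cs1)"
    using settled_representative[OF \<phi> i fix_i] by blast
  have "hd (rep (cval (a, p))) \<noteq> (i, True)"
    using hd rep_cval[OF c(1)] by (auto simp: starts_def c(2))
  with i(2) obtain cs1 b u cs2 where cs: "cs = cs1 @ (b, u) # cs2"
    "let h = cval (a, p) + sum_list (map cval cs1); B = h + cval (b, u) + - h
     in B = tg i \<or> length (rep B) < length (rep (cval (a, p))) \<and> hd (rep B) \<noteq> (i, True)"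
    using mark_after_middle[OF c(3,1) _ c(4)] by (metis less_imp_le)
  obtain \<psi> where \<psi>: "\<psi> \<in> Gfrom n (Suc i)" "gimg (bcomp n \<psi> \<phi>) (Suc i) =
     sum_list (map cval cs1) + cval (b, u) + - sum_list (map cval cs1)"
    using move[OF cs(1)] by blast
  have "bcomp n \<psi> \<phi> \<in> Bn n" using \<psi>(1) Gfrom_Bn[of "Suc i" n] \<phi> by (auto intro: bcomp_in_Bn)
  from gimg_binv_sigma[OF this, of i i]
  have "gimg (bcomp n (binv n (sigma n i)) (bcomp n \<psi> \<phi>)) i =
     (cval (a, p) + sum_list (map cval cs1)) + cval (b, u) + - (cval (a, p) + sum_list (map cval cs1))"
    using gimg_Gfrom[OF \<psi>(1) \<phi>, of i] i by (simp add: \<psi>(2) c(2) grp_simps)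
  with cs(2) show thesis
    by (intro that[OF \<psi>(1)]) (auto simp: Let_def c(2) starts_def)
qed

lemma negative_step:
  assumes \<phi>: "\<phi> \<in> Bn n" and i: "1 \<le> i" "i < n" and fix_i: "fixes_below i \<phi>"
    and hd: "starts i (rep (gimg \<phi> i))" "gimg \<phi> i \<noteq> tg i"
  obtains \<psi> where "\<psi> \<in> Gfrom n (Suc i)"
    "let B = gimg (bcomp n (sigma n i) (bcomp n \<psi> \<phi>)) i
     in B = tg i \<or> length (rep B) < length (rep (gimg \<phi> i)) \<and> starts i (rep B)"
proof -
  obtain a p cs where c: "tight (a, p)" "gimg \<phi> i = cval (a, p)" "settled cs"
    "sum_list (map cval cs) = - cval (a, p) + cl (tword i n)"
    and move: "\<And>cs1 c cs2. cs = cs1 @ c # cs2 \<Longrightarrow> \<exists>\<psi>\<in>Gfrom n (Suc i).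
       gimg (bcomp n \<psi> \<phi>) (Suc i) = sum_list (map cval cs1) + cval c + - sum_list (map cval cs1)"
    using settled_representative[OF \<phi> i fix_i] by blast
  \<comment> \<open>With \<open>p\<close> empty, \<open>A_i\<close> would be a generator that starts
    with \<open>t_i\<close>, hence \<open>t_i\<close> itself.\<close>
  have "p \<noteq> []" using hd by (auto simp: starts_def c(2) cval_def)
  moreover from this have "hd p = (i, True)"
    using hd rep_cval[OF c(1)] by (auto simp: starts_def c(2))
  ultimately obtain cs1 b u cs2 where cs: "cs = cs1 @ (b, u) # cs2"
    "let h = sum_list (map cval cs1); B = h + cval (b, u) + - h
     in B = tg i \<or> length (rep B) < length (rep (cval (a, p))) \<and> hd (rep B) = (i, True)"
    using mark_before_middle[OF c(3,1,4)] by metis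
  obtain \<psi> where \<psi>: "\<psi> \<in> Gfrom n (Suc i)" "gimg (bcomp n \<psi> \<phi>) (Suc i) =
     sum_list (map cval cs1) + cval (b, u) + - sum_list (map cval cs1)"
    using move[OF cs(1)] by blast
  have "bcomp n \<psi> \<phi> \<in> Bn n" using \<psi>(1) Gfrom_Bn[of "Suc i" n] \<phi> by (auto intro: bcomp_in_Bn)
  from gimg_sigma[OF this, of i i]
  have B: "gimg (bcomp n (sigma n i) (bcomp n \<psi> \<phi>)) i =
     sum_list (map cval cs1) + cval (b, u) + - sum_list (map cval cs1)"
    using i by (simp add: \<psi>(2))
  \<comment> \<open>\<open>starts\<close> demands a nonempty word, which the equation for
    \<open>hd\<close> alone does not give; so \<open>B\<close> has to be shown nontrivial.\<close>
  have "tight (b, u)" using c(3) cs(1) by simp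
  then have "cval (b, u) \<noteq> 0" using rep_cval[of b u] by auto
  then have "sum_list (map cval cs1) + cval (b, u) + - sum_list (map cval cs1) \<noteq> 0"
    using eq_neg_iff_add_eq_0[of "sum_list (map cval cs1) + cval (b, u)" "- sum_list (map cval cs1)"]
      add_left_cancel[of "sum_list (map cval cs1)" "cval (b, u)" 0] by simp
  with B cs(2) show thesis
    by (intro that[OF \<psi>(1)]) (auto simp: Let_def c(2) starts_def)
qed

lemma bcomp_cancel_left:
  assumes "\<phi> \<in> Bn n" "\<psi> \<in> Bn n"
  shows "bcomp n (binv n \<psi>) (bcomp n \<psi> \<phi>) = \<phi>"
  using bcomp_assoc[OF binv_in_Bn[OF assms(2)], of \<psi> \<phi>] assms
  by (simp add: bcomp_binv_left bcomp_bone_left)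

text \<open>Induction on the length of \<open>A_i\<close> with
  \<open>\<phi> = \<psi>^-1 \<sigma>_i \<chi>\<close>: either \<open>\<chi>\<close> falls under the
  induction hypothesis, or it fixes \<open>t_i\<close> as well and \<open>fixer\<close> applies. The
  assumption \<open>fixer\<close> separates this induction from the one over \<open>i\<close> in
  \<open>Gfrom_if_fixes_below\<close>.\<close>

lemma Pfrom_if_not_starts:
  assumes "\<phi> \<in> Bn n" "1 \<le> i" "i < n" "fixes_below i \<phi>" "\<not> starts i (rep (gimg \<phi> i))"
    and fixer: "\<And>\<chi>. \<chi> \<in> Bn n \<Longrightarrow> fixes_below (Suc i) \<chi> \<Longrightarrow> \<chi> \<in> Gfrom n (Suc i)"
  shows "\<phi> \<in> Pfrom n i"
  using assms(1,4,5)
proof (induction "length (rep (gimg \<phi> i))" arbitrary: \<phi> rule: less_induct)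
  case less
  obtain \<psi> where \<psi>: "\<psi> \<in> Gfrom n (Suc i)"
    "let B = gimg (bcomp n (binv n (sigma n i)) (bcomp n \<psi> \<phi>)) i
     in B = tg i \<or> length (rep B) < length (rep (gimg \<phi> i)) \<and> \<not> starts i (rep B)"
    using positive_step[OF less.prems(1) assms(2,3) less.prems(2,3)] by blast
  have \<psi>B: "\<psi> \<in> Bn n" using \<psi>(1) Gfrom_Bn[of "Suc i" n] by auto
  have s: "sigma n i \<in> Bn n" using assms by (intro sigma_in_Bn) auto
  define \<chi> where "\<chi> = bcomp n (binv n (sigma n i)) (bcomp n \<psi> \<phi>)"
  have \<psi>\<phi>: "bcomp n \<psi> \<phi> \<in> Bn n" by (rule bcomp_in_Bn[OF \<psi>B less.prems(1)])
  have \<chi>B: "\<chi> \<in> Bn n" unfolding \<chi>_def by (intro bcomp_in_Bn binv_in_Bn s \<psi>\<phi>)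
  have "fixes_below i (bcomp n \<psi> \<phi>)"
    using fixes_below_Gfrom[OF \<psi>(1) less.prems(1) _ less.prems(2)] assms(3) by simp
  then have fix_\<chi>: "fixes_below i \<chi>"
    using gimg_binv_sigma[OF \<psi>\<phi>, of i] assms(2,3) by (auto simp: \<chi>_def)
  have "\<chi> \<in> Gfrom n (Suc i) \<union> Pfrom n i"
  proof (cases "gimg \<chi> i = tg i")
    case True
    with fix_\<chi> have "fixes_below (Suc i) \<chi>" by (auto simp: less_Suc_eq)
    with fixer \<chi>B show ?thesis by blast
  next
    case False
    with \<psi>(2) have "length (rep (gimg \<chi> i)) < length (rep (gimg \<phi> i))" "\<not> starts i (rep (gimg \<chi> i))"
      by (auto simp: \<chi>_def Let_def)
    with less.hyps \<chi>B fix_\<chi> show ?thesis by blast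
  qed
  then have "bcomp n (sigma n i) \<chi> \<in> Pfrom n i"
    using Pfrom_absorb(1)[OF assms(2) sigma_Pfrom[OF assms(2,3)]] by blast
  moreover have "bcomp n (sigma n i) \<chi> = bcomp n \<psi> \<phi>"
    using bcomp_cancel_left[OF \<psi>\<phi> binv_in_Bn[OF s]] by (simp add: \<chi>_def binv_binv s)
  ultimately have "bcomp n (binv n \<psi>) (bcomp n \<psi> \<phi>) \<in> Pfrom n i"
    using Pfrom_absorb(2)[OF assms(2)] binv_Gfrom[OF _ \<psi>(1)] by simp
  then show ?case using bcomp_cancel_left[OF less.prems(1) \<psi>B] by simp
qed

text \<open>The same descent with \<open>\<phi>^-1 = \<chi>^-1 \<sigma>_i \<psi>\<close>.\<close>

lemma binv_Pfrom_if_starts: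
  assumes "\<phi> \<in> Bn n" "1 \<le> i" "i < n" "fixes_below i \<phi>" "starts i (rep (gimg \<phi> i))" "gimg \<phi> i \<noteq> tg i"
    and fixer: "\<And>\<chi>. \<chi> \<in> Bn n \<Longrightarrow> fixes_below (Suc i) \<chi> \<Longrightarrow> \<chi> \<in> Gfrom n (Suc i)"
  shows "binv n \<phi> \<in> Pfrom n i"
  using assms(1,4,5,6)
proof (induction "length (rep (gimg \<phi> i))" arbitrary: \<phi> rule: less_induct)
  case less
  obtain \<psi> where \<psi>: "\<psi> \<in> Gfrom n (Suc i)"
    "let B = gimg (bcomp n (sigma n i) (bcomp n \<psi> \<phi>)) i
     in B = tg i \<or> length (rep B) < length (rep (gimg \<phi> i)) \<and> starts i (rep B)"
    using negative_step[OF less.prems(1) assms(2,3) less.prems(2,3,4)] by blast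
  have \<psi>B: "\<psi> \<in> Bn n" using \<psi>(1) Gfrom_Bn[of "Suc i" n] by auto
  have s: "sigma n i \<in> Bn n" using assms by (intro sigma_in_Bn) auto
  define \<chi> where "\<chi> = bcomp n (sigma n i) (bcomp n \<psi> \<phi>)"
  have \<psi>\<phi>: "bcomp n \<psi> \<phi> \<in> Bn n" by (rule bcomp_in_Bn[OF \<psi>B less.prems(1)])
  have \<chi>B: "\<chi> \<in> Bn n" unfolding \<chi>_def by (intro bcomp_in_Bn s \<psi>\<phi>)
  have "fixes_below i (bcomp n \<psi> \<phi>)"
    using fixes_below_Gfrom[OF \<psi>(1) less.prems(1) _ less.prems(2)] assms(3) by simp
  then have fix_\<chi>: "fixes_below i \<chi>"
    using gimg_sigma[OF \<psi>\<phi>, of i] assms(2,3) by (auto simp: \<chi>_def)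
  have "binv n \<chi> \<in> Gfrom n (Suc i) \<union> Pfrom n i"
  proof (cases "gimg \<chi> i = tg i")
    case True
    with fix_\<chi> have "fixes_below (Suc i) \<chi>" by (auto simp: less_Suc_eq)
    with fixer[OF \<chi>B] binv_Gfrom[of "Suc i" \<chi> n] show ?thesis by simp
  next
    case False
    with \<psi>(2) have "length (rep (gimg \<chi> i)) < length (rep (gimg \<phi> i))" "starts i (rep (gimg \<chi> i))"
      by (auto simp: \<chi>_def Let_def)
    with less.hyps \<chi>B fix_\<chi> False show ?thesis by blast
  qed
  then have "bcomp n (bcomp n (binv n \<chi>) (sigma n i)) \<psi> \<in> Pfrom n i"
    using Pfrom_absorb[OF assms(2)] sigma_Pfrom[OF assms(2,3)] \<psi>(1) by blast
  moreover have "binv n \<chi> = bcomp n (bcomp n (binv n \<phi>) (binv n \<psi>)) (binv n (sigma n i))"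
    using less.prems(1) \<psi>B s \<psi>\<phi> by (simp add: \<chi>_def binv_bcomp)
  then have "bcomp n (bcomp n (binv n \<chi>) (sigma n i)) \<psi> = binv n \<phi>"
    using less.prems(1) \<psi>B s
    by (simp add: bcomp_assoc bcomp_in_Bn binv_in_Bn bcomp_binv_left bcomp_bone_right bcomp_bone_left)
  ultimately show ?case by simp
qed

text \<open>Downward induction from \<open>i = n\<close>, where the product condition forces the
  last image. The case \<open>i = 1\<close> is Artin's theorem that the \<open>\<sigma>_j\<close>
  generate \<open>Bn n\<close>.\<close>

lemma Gfrom_if_fixes_below:
  assumes "i \<le> n" "1 \<le> i" "\<phi> \<in> Bn n" "fixes_below i \<phi>"
  shows "\<phi> \<in> Gfrom n i"
  using assms
proof (induction i arbitrary: \<phi> rule: inc_induct)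
  case base
  have "gimg \<phi> n = tg n" using gimg_last base by blast
  with base.prems have "\<forall>k\<in>{1..n}. gimg \<phi> k = tg k" by (auto simp: le_less)
  then have "\<phi> = bone n" using fixes_all_imp_bone base.prems by blast
  then show ?case by (simp add: bone_Gfrom)
next
  case (step i)
  have fixer: "\<chi> \<in> Gfrom n (Suc i)" if "\<chi> \<in> Bn n" "fixes_below (Suc i) \<chi>" for \<chi>
    using step.IH that by simp
  consider "gimg \<phi> i = tg i" | "gimg \<phi> i \<noteq> tg i" "starts i (rep (gimg \<phi> i))" | "\<not> starts i (rep (gimg \<phi> i))"
    by blast
  then show ?case
  proof cases
    case 1
    with step.prems have "fixes_below (Suc i) \<phi>" by (auto simp: less_Suc_eq)
    with fixer step.prems Gfrom_mono[of i "Suc i" n] show ?thesis by auto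
  next
    case 2
    then have "binv n \<phi> \<in> Pfrom n i"
      using binv_Pfrom_if_starts[OF step.prems(2,1) step.hyps(2) step.prems(3)] fixer by blast
    then have "binv n (binv n \<phi>) \<in> Gfrom n i"
      using Pfrom_Gfrom binv_Gfrom[OF step.prems(1)] by blast
    then show ?thesis using step.prems by (simp add: binv_binv)
  next
    case 3
    then have "\<phi> \<in> Pfrom n i"
      using Pfrom_if_not_starts[OF step.prems(2,1) step.hyps(2) step.prems(3)] fixer by blast
    then show ?thesis using Pfrom_Gfrom by blast
  qed
qed

lemma Ppos_trichotomy:
  assumes "\<phi> \<in> Bn n" "\<phi> \<noteq> bone n"
  shows "\<phi> \<in> Ppos n \<or> binv n \<phi> \<in> Ppos n"
proof -
  define Q where "Q i \<longleftrightarrow> i \<in> {1..n} \<and> gimg \<phi> i \<noteq> tg i" for i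
  define i where "i = (LEAST i. Q i)"
  have "\<exists>i. Q i"
    using fixes_all_imp_bone[OF assms(1)] assms(2) by (auto simp: Q_def)
  then have "Q i" unfolding i_def by (rule LeastI_ex)
  then have i: "1 \<le> i" "i \<le> n" "gimg \<phi> i \<noteq> tg i" by (simp_all add: Q_def)
  have below: "fixes_below i \<phi>"
  proof
    fix k assume k: "k \<in> {1..<i}"
    then have "\<not> Q k" using not_less_Least[of k Q] by (simp add: i_def)
    with k i(2) show "gimg \<phi> k = tg k" by (simp add: Q_def)
  qed
  \<comment> \<open>If \<open>t_1, ..., t_{n-1}\<close> are fixed, then so is \<open>t_n\<close>.
    Hence \<open>\<sigma>_i\<close> exists for the first generator \<open>t_i\<close> that is
    moved.\<close>
  have "i \<noteq> n" using gimg_last[OF assms(1)] below i by auto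
  with i(2) have "i < n" by simp
  then have fixer: "\<chi> \<in> Gfrom n (Suc i)" if "\<chi> \<in> Bn n" "fixes_below (Suc i) \<chi>" for \<chi>
    using Gfrom_if_fixes_below[of "Suc i" n] that by simp
  have "\<phi> \<in> Pfrom n i \<or> binv n \<phi> \<in> Pfrom n i"
    using Pfrom_if_not_starts[OF assms(1) i(1) \<open>i < n\<close> below] fixer
      binv_Pfrom_if_starts[OF assms(1) i(1) \<open>i < n\<close> below] i(3) by blast
  then show ?thesis using i(1) \<open>i < n\<close> by (auto simp: Ppos_eq)
qed

section \<open>The positive cone and its ordering\<close>

lemma Ppos_Bn: "\<phi> \<in> Ppos n \<Longrightarrow> \<phi> \<in> Bn n"
  by (simp add: Ppos_def)

text \<open>If the indices differ, the factor with the larger one involves only generators above the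
  smaller one and is absorbed.\<close>

lemma Ppos_bcomp:
  assumes "\<phi> \<in> Ppos n" "\<psi> \<in> Ppos n"
  shows "bcomp n \<phi> \<psi> \<in> Ppos n"
proof -
  obtain i j where i: "i \<in> {1..<n}" "\<phi> \<in> Pfrom n i" and j: "j \<in> {1..<n}" "\<psi> \<in> Pfrom n j"
    using assms by (auto simp: Ppos_eq)
  consider "i = j" | "Suc i \<le> j" | "Suc j \<le> i" by linarith
  then have "bcomp n \<phi> \<psi> \<in> Pfrom n i \<or> bcomp n \<phi> \<psi> \<in> Pfrom n j"
  proof cases
    case 1
    then show ?thesis using Pfrom_absorb(1)[of i \<phi> n \<psi>] i j by auto
  next
    case 2
    then have "\<psi> \<in> Gfrom n (Suc i)" using j(2) Pfrom_Gfrom Gfrom_mono by blast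
    then show ?thesis using Pfrom_absorb(1)[of i \<phi> n \<psi>] i by auto
  next
    case 3
    then have "\<phi> \<in> Gfrom n (Suc j)" using i(2) Pfrom_Gfrom Gfrom_mono by blast
    then show ?thesis using Pfrom_absorb(2)[of j \<psi> n \<phi>] j by auto
  qed
  then show ?thesis using i j by (auto simp: Ppos_eq)
qed

text \<open>Otherwise the identity, as their product, would be in \<open>Ppos n\<close>.\<close>

lemma not_both_Ppos: "\<phi> \<in> Ppos n \<Longrightarrow> binv n \<phi> \<notin> Ppos n"
  using Ppos_bcomp[of \<phi> n "binv n \<phi>"] bcomp_binv_right[OF Ppos_Bn] bone_not_Ppos by auto

theorem theorem6p7:
  fixes n :: nat
  assumes "n \<ge> 1"
  shows "(\<forall>\<phi> \<in> Bn n.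
            (\<phi> = bone n \<and> \<phi> \<notin> Ppos n \<and> binv n \<phi> \<notin> Ppos n)
          \<or> (\<phi> \<noteq> bone n \<and> \<phi> \<in> Ppos n \<and> binv n \<phi> \<notin> Ppos n)
          \<or> (\<phi> \<noteq> bone n \<and> \<phi> \<notin> Ppos n \<and> binv n \<phi> \<in> Ppos n))
       \<and> (\<forall>\<phi> \<in> Ppos n. \<forall>\<psi> \<in> Ppos n. bcomp n \<phi> \<psi> \<in> Ppos n)
       \<and> (\<forall>\<phi> \<in> Bn n. \<not> bless n \<phi> \<phi>)
       \<and> (\<forall>\<phi> \<in> Bn n. \<forall>\<psi> \<in> Bn n. \<forall>\<chi> \<in> Bn n.
            bless n \<phi> \<psi> \<longrightarrow> bless n \<psi> \<chi> \<longrightarrow> bless n \<phi> \<chi>)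
       \<and> (\<forall>\<phi> \<in> Bn n. \<forall>\<psi> \<in> Bn n. \<phi> = \<psi> \<or> bless n \<phi> \<psi> \<or> bless n \<psi> \<phi>)
       \<and> (\<forall>\<phi> \<in> Bn n. \<forall>\<psi> \<in> Bn n. \<forall>\<chi> \<in> Bn n.
            bless n \<phi> \<psi> \<longrightarrow> bless n (bcomp n \<phi> \<chi>) (bcomp n \<psi> \<chi>))"
proof (intro conjI ballI impI)
  fix \<phi> assume \<phi>: "\<phi> \<in> Bn n"
  show "(\<phi> = bone n \<and> \<phi> \<notin> Ppos n \<and> binv n \<phi> \<notin> Ppos n)
          \<or> (\<phi> \<noteq> bone n \<and> \<phi> \<in> Ppos n \<and> binv n \<phi> \<notin> Ppos n)
          \<or> (\<phi> \<noteq> bone n \<and> \<phi> \<notin> Ppos n \<and> binv n \<phi> \<in> Ppos n)"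
  proof (cases "\<phi> = bone n")
    case True
    then show ?thesis by (simp add: bone_not_Ppos binv_bone)
  next
    case False
    then show ?thesis using Ppos_trichotomy[OF \<phi>] not_both_Ppos[of \<phi> n] by blast
  qed
  show "\<not> bless n \<phi> \<phi>"
    by (simp add: bless_def bcomp_binv_right \<phi> bone_not_Ppos)
next
  fix \<phi> \<psi> assume "\<phi> \<in> Ppos n" "\<psi> \<in> Ppos n"
  then show "bcomp n \<phi> \<psi> \<in> Ppos n" by (rule Ppos_bcomp)
next
  fix \<phi> \<psi> \<chi> assume B: "\<phi> \<in> Bn n" "\<psi> \<in> Bn n" "\<chi> \<in> Bn n" and "bless n \<phi> \<psi>" "bless n \<psi> \<chi>"
  \<comment> \<open>The product of \<open>\<chi> \<psi>^-1\<close> and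
    \<open>\<psi> \<phi>^-1\<close> telescopes.\<close>
  then have "bcomp n (bcomp n \<chi> (binv n \<psi>)) (bcomp n \<psi> (binv n \<phi>)) \<in> Ppos n"
    by (simp add: bless_def Ppos_bcomp)
  moreover have "bcomp n (bcomp n \<chi> (binv n \<psi>)) (bcomp n \<psi> (binv n \<phi>)) = bcomp n \<chi> (binv n \<phi>)"
    using B bcomp_cancel_left[of "binv n \<phi>" n \<psi>] by (simp add: bcomp_assoc binv_in_Bn)
  ultimately show "bless n \<phi> \<chi>" by (simp add: bless_def)
next
  fix \<phi> \<psi> assume B: "\<phi> \<in> Bn n" "\<psi> \<in> Bn n"
  \<comment> \<open>Totality is trichotomy for \<open>\<psi> \<phi>^-1\<close>, whose inverse
    compares the two elements in the other order.\<close>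
  let ?\<chi> = "bcomp n \<psi> (binv n \<phi>)"
  have "binv n ?\<chi> = bcomp n \<phi> (binv n \<psi>)"
    using B by (simp add: binv_bcomp binv_in_Bn binv_binv)
  moreover have "\<phi> = \<psi>" if "?\<chi> = bone n"
  proof -
    have "\<psi> = bcomp n ?\<chi> \<phi>" using B by (simp add: bcomp_assoc bcomp_binv_left bcomp_bone_right)
    with that B show ?thesis by (simp add: bcomp_bone_left)
  qed
  ultimately show "\<phi> = \<psi> \<or> bless n \<phi> \<psi> \<or> bless n \<psi> \<phi>"
    using Ppos_trichotomy[of ?\<chi> n] B by (auto simp: bless_def bcomp_in_Bn binv_in_Bn)
next
  fix \<phi> \<psi> \<chi> assume B: "\<phi> \<in> Bn n" "\<psi> \<in> Bn n" "\<chi> \<in> Bn n" and "bless n \<phi> \<psi>"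
  \<comment> \<open>Right invariance: \<open>\<chi>\<close> cancels in
    \<open>(\<psi> \<chi>) (\<phi> \<chi>)^-1\<close>.\<close>
  have "bcomp n \<chi> (bcomp n (binv n \<chi>) (binv n \<phi>)) = binv n \<phi>"
    using bcomp_cancel_left[of "binv n \<phi>" n "binv n \<chi>"] B by (simp add: binv_in_Bn binv_binv)
  then have "bcomp n (bcomp n \<psi> \<chi>) (binv n (bcomp n \<phi> \<chi>)) = bcomp n \<psi> (binv n \<phi>)"
    using B by (simp add: binv_bcomp bcomp_assoc)
  with \<open>bless n \<phi> \<psi>\<close> show "bless n (bcomp n \<phi> \<chi>) (bcomp n \<psi> \<chi>)" by (simp add: bless_def)
qed

end
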